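(* Let $(G,c)$ be an infinite network satisfying the standing assumptions. If $\Delta_2$ has a spectral gap, then the wired effective resistance is bounded. More precisely, if $\gamma>0$ and $\operatorname{spec}\Delta_2\subseteq[\gamma,\infty)$, then $$R^W(x,y)\le\frac{2}{\gamma}\qquad\text{for all }x,y\in G.$$
   Context: A network $(G,c)$ is a connected undirected graph $G$ (we write $x\in G$ for vertices) with a symmetric conductance function $c:G\times G\to[0,\infty)$, where $x,y$ are neighbours, $x\sim y$, iff $c_{xy}>0$. Every vertex has finitely many neighbours. Fix a reference vertex $o\in G$. The Laplacian acts on $u:G\to\mathbb R$ by $(\Delta u)(x)=\sum_{y\sim x}c_{xy}(u(x)-u(y))$. The energy form is $\mathcal E(u,v)=\frac12\sum_{x,y\in G}c_{xy}(u(x)-u(y))(v(x)-v(y))$ on $\operatorname{dom}\mathcal E=\{u:G\to\mathbb R:\mathcal E(u,u)<\infty\}$, and $\mathcal E(u)=\mathcal E(u,u)$. The energy space $\mathcal H_{\mathcal E}=\operatorname{dom}\mathcal E/\mathbb R\mathbf 1$ (functions modulo constants) is a Hilbert space with inner product $\langle u,v\rangle_{\mathcal E}=\mathcal E(u,v)$. For $x\in G$, $v_x\in\mathcal H_{\mathcal E}$ is the unique element with $\langle v_x,u\rangle_{\mathcal E}=u(x)-u(o)$ for all $u\in\mathcal H_{\mathcal E}$. Let $\delta_x$ be the characteristic function of $\{x\}$. $\mathrm{Fin}$ is the closure in $\mathcal H_{\mathcal E}$ of $\operatorname{span}\{\delta_x\}_{x\in G}$, $P_{\mathrm{Fin}}$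 is the orthogonal projection of $\mathcal H_{\mathcal E}$ onto it, and $f_x:=P_{\mathrm{Fin}}v_x$. The wired effective resistance is $R^W(x,y):=\mathcal E(f_x-f_y)$. Standing assumption: the network is transient, i.e. for some (equivalently every) $x$ there is $w\in\mathcal H_{\mathcal E}$ with $\Delta w=\delta_x$. $\ell^2(G)$ carries $\langle u,v\rangle_2=\sum_x u(x)v(x)$, and $\Delta_2$ is the closure in $\ell^2(G)$ of $\Delta$ on $\operatorname{span}\{\delta_x\}_{x\in G}$; it is known to be self-adjoint and non-negative. Spectral gap means $\inf\operatorname{spec}\Delta_2>0$. *)

theory Defs
  imports "HOL-Analysis.Analysis"
begin

section \<open>Networks\<close>

text \<open>The vertex set is the whole type \<open>'a\<close>; loops (\<open>c x x > 0\<close>) are not excluded, and do not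
  contribute to the Laplacian or to the energy.\<close>

locale network =
  fixes c :: "'a \<Rightarrow> 'a \<Rightarrow> real"
  assumes symmetric: "c x y = c y x"
    and nonneg: "0 \<le> c x y"
    and locally_finite: "finite {y. c x y > 0}"
    and connected: "(\<lambda>u v. c u v > 0)\<^sup>*\<^sup>* x y"

definition laplacian :: "('a \<Rightarrow> 'a \<Rightarrow> real) \<Rightarrow> ('a \<Rightarrow> real) \<Rightarrow> 'a \<Rightarrow> real" where
  "laplacian c u x = (\<Sum>y\<in>{y. c x y > 0}. c x y * (u x - u y))"

definition dirac :: "'a \<Rightarrow> 'a \<Rightarrow> real" where
  "dirac x = indicator {x}"

definition dirac_span :: "('a \<Rightarrow> real) set" where
  "dirac_span = {\<lambda>z. \<Sum>x\<in>A. a x * dirac x z | A a. finite A}"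


section \<open>The energy space\<close>

definition energy :: "('a \<Rightarrow> 'a \<Rightarrow> real) \<Rightarrow> ('a \<Rightarrow> real) \<Rightarrow> ('a \<Rightarrow> real) \<Rightarrow> real" where
  "energy c u v = 1/2 * infsum (\<lambda>(x, y). c x y * (u x - u y) * (v x - v y)) UNIV"

definition dom_energy :: "('a \<Rightarrow> 'a \<Rightarrow> real) \<Rightarrow> ('a \<Rightarrow> real) set" where
  "dom_energy c = {u. (\<lambda>(x, y). c x y * (u x - u y) * (u x - u y)) summable_on UNIV}"

definition mod_const :: "('a \<Rightarrow> 'a \<Rightarrow> real) \<Rightarrow> (('a \<Rightarrow> real) \<times> ('a \<Rightarrow> real)) set" where
  "mod_const c = {(u, v). u \<in> dom_energy c \<and> v \<in> dom_energy c \<and> (\<exists>k. \<forall>x. u x - v x = k)}"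

text \<open>Elements of the energy space are cosets, i.e. sets of functions.\<close>

definition energy_space :: "('a \<Rightarrow> 'a \<Rightarrow> real) \<Rightarrow> ('a \<Rightarrow> real) set set" where
  "energy_space c = dom_energy c // mod_const c"

definition coset_diff :: "('a \<Rightarrow> real) set \<Rightarrow> ('a \<Rightarrow> real) set \<Rightarrow> ('a \<Rightarrow> real) set" where
  "coset_diff U V = {\<lambda>x. u x - v x | u v. u \<in> U \<and> v \<in> V}"

text \<open>On cosets in the energy space the set of values of \<open>energy c\<close> on representatives
  is a singleton.\<close>

definition energy_inner ::
    "('a \<Rightarrow> 'a \<Rightarrow> real) \<Rightarrow> ('a \<Rightarrow> real) set \<Rightarrow> ('a \<Rightarrow> real) set \<Rightarrow> real" where
  "energy_inner c U V = the_elem {energy c u v | u v. u \<in> U \<and> v \<in> V}"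

definition energy_norm :: "('a \<Rightarrow> 'a \<Rightarrow> real) \<Rightarrow> ('a \<Rightarrow> real) set \<Rightarrow> real" where
  "energy_norm c U = sqrt (energy_inner c U U)"

definition transient :: "('a \<Rightarrow> 'a \<Rightarrow> real) \<Rightarrow> bool" where
  "transient c \<longleftrightarrow> (\<exists>x. \<exists>W\<in>energy_space c. \<forall>w\<in>W. laplacian c w = dirac x)"

text \<open>The element \<open>v\<^sub>x\<close> representing \<open>u \<mapsto> u(x) - u(x\<^sub>0)\<close>, where \<open>x\<^sub>0\<close> is the reference vertex.\<close>

definition dipole :: "('a \<Rightarrow> 'a \<Rightarrow> real) \<Rightarrow> 'a \<Rightarrow> 'a \<Rightarrow> ('a \<Rightarrow> real) set" where
  "dipole c x\<^sub>0 x = (THE V. V \<in> energy_space c \<and>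
     (\<forall>U\<in>energy_space c. \<forall>u\<in>U. energy_inner c V U = u x - u x\<^sub>0))"

definition Fin :: "('a \<Rightarrow> 'a \<Rightarrow> real) \<Rightarrow> ('a \<Rightarrow> real) set set" where
  "Fin c = {U \<in> energy_space c. \<exists>\<phi> :: nat \<Rightarrow> 'a \<Rightarrow> real. (\<forall>n. \<phi> n \<in> dirac_span) \<and>
     (\<lambda>n. energy_norm c (coset_diff (mod_const c `` {\<phi> n}) U)) \<longlonglongrightarrow> 0}"

definition proj_Fin :: "('a \<Rightarrow> 'a \<Rightarrow> real) \<Rightarrow> ('a \<Rightarrow> real) set \<Rightarrow> ('a \<Rightarrow> real) set" where
  "proj_Fin c U = (THE F. F \<in> Fin c \<and> (\<forall>W\<in>Fin c. energy_inner c (coset_diff U F) W = 0))"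

definition wired_resistance :: "('a \<Rightarrow> 'a \<Rightarrow> real) \<Rightarrow> 'a \<Rightarrow> 'a \<Rightarrow> 'a \<Rightarrow> real" where
  "wired_resistance c x\<^sub>0 x y =
     (let d = coset_diff (proj_Fin c (dipole c x\<^sub>0 x)) (proj_Fin c (dipole c x\<^sub>0 y))
      in energy_inner c d d)"


section \<open>The Laplacian on square-summable functions\<close>

definition l2 :: "('a \<Rightarrow> real) set" where
  "l2 = {u. (\<lambda>x. u x * u x) summable_on UNIV}"

definition l2_inner :: "('a \<Rightarrow> real) \<Rightarrow> ('a \<Rightarrow> real) \<Rightarrow> real" where
  "l2_inner u v = infsum (\<lambda>x. u x * v x) UNIV"

definition l2_norm :: "('a \<Rightarrow> real) \<Rightarrow> real" where
  "l2_norm u = sqrt (l2_inner u u)"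

text \<open>Unbounded operators in \<open>l2\<close> are represented by their graphs. The graph of the closure of
  an operator is the closure of its graph in the product of \<open>l2\<close> with itself.\<close>

definition laplacian2 :: "('a \<Rightarrow> 'a \<Rightarrow> real) \<Rightarrow> (('a \<Rightarrow> real) \<times> ('a \<Rightarrow> real)) set" where
  "laplacian2 c = {(u, w). u \<in> l2 \<and> w \<in> l2 \<and>
     (\<exists>\<phi> :: nat \<Rightarrow> 'a \<Rightarrow> real. (\<forall>n. \<phi> n \<in> dirac_span) \<and>
        (\<lambda>n. l2_norm (\<lambda>x. \<phi> n x - u x)) \<longlonglongrightarrow> 0 \<and>
        (\<lambda>n. l2_norm (\<lambda>x. laplacian c (\<phi> n) x - w x)) \<longlonglongrightarrow> 0)}"

text \<open>\<open>r\<close> is in the resolvent set of \<open>T\<close> iff \<open>T - r\<close> is a bijection from the domain of \<open>T\<close> onto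
  \<open>l2\<close> whose inverse is bounded. As \<open>l2\<close> is a real Hilbert space, \<open>r\<close> ranges over the reals; for a
  self-adjoint operator this gives the same spectrum as its complexification.\<close>

definition resolvent_set :: "(('a \<Rightarrow> real) \<times> ('a \<Rightarrow> real)) set \<Rightarrow> real set" where
  "resolvent_set T = {r.
     (\<forall>f\<in>l2. \<exists>!u. \<exists>w. (u, w) \<in> T \<and> (\<lambda>x. w x - r * u x) = f) \<and>
     (\<exists>C. \<forall>(u, w)\<in>T. l2_norm u \<le> C * l2_norm (\<lambda>x. w x - r * u x))}"

definition spec :: "(('a \<Rightarrow> real) \<times> ('a \<Rightarrow> real)) set \<Rightarrow> real set" where
  "spec T = - resolvent_set T"

text \<open>The infimum is taken in the extended reals, since the infimum of an empty or unbounded set of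
  reals is an unspecified value in type \<open>real\<close>.\<close>

definition spectral_gap :: "(('a \<Rightarrow> real) \<times> ('a \<Rightarrow> real)) set \<Rightarrow> bool" where
  "spectral_gap T \<longleftrightarrow> (INF r\<in>spec T. ereal r) > 0"

end

theory Submission
  imports Defs
begin

text \<open>The difference \<open>h = f\<^sub>x - f\<^sub>y\<close> of the projected dipoles is the element of \<open>Fin\<close> that represents
  the functional \<open>\<phi> \<mapsto> \<phi>(x) - \<phi>(y)\<close> in the energy inner product, and the wired resistance is its
  energy. So the resistance is the squared norm of this functional on finitely supported \<open>\<phi>\<close>, which
  are dense in \<open>Fin\<close>. For such \<open>\<phi>\<close>,
  \<open>(\<phi>(x) - \<phi>(y))\<^sup>2 \<le> 2 (\<phi>(x)\<^sup>2 + \<phi>(y)\<^sup>2) \<le> 2 \<parallel>\<phi>\<parallel>\<^sup>2\<close> when \<open>x \<noteq> y\<close>, and a spectral gap \<open>\<gamma>\<close> gives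
  \<open>\<gamma> \<parallel>\<phi>\<parallel>\<^sup>2 \<le> \<langle>\<Delta>\<phi>, \<phi>\<rangle> = \<E>(\<phi>)\<close>. Hence the functional has squared norm at most \<open>2 / \<gamma>\<close>
  (\<open>wired_resistance_le\<close>).

  Two steps carry the weight. The first is the inequality \<open>\<gamma> \<parallel>\<phi>\<parallel>\<^sup>2 \<le> \<E>(\<phi>)\<close>
  (\<open>poincare_inequality\<close>), which is obtained without a spectral theorem: the infimum \<open>m\<close> of the
  Rayleigh quotients \<open>\<E>(\<phi>) / \<parallel>\<phi>\<parallel>\<^sup>2\<close> lies in the spectrum, and therefore \<open>m \<ge> \<gamma>\<close>. Indeed, if
  \<open>\<Delta>\<^sub>2 - m\<close> had a bounded inverse, the Cauchy--Schwarz inequality for the non-negative form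
  \<open>q(u, v) = \<langle>(\<Delta> - m) u, v\<rangle>\<close>, applied to \<open>\<phi>\<close> and \<open>(\<Delta>\<^sub>2 - m)\<^sup>-\<^sup>1 \<phi>\<close>, would bound \<open>\<parallel>\<phi>\<parallel>\<^sup>2\<close> by a constant
  times \<open>q(\<phi>, \<phi>)\<close>, and the infimum would not be \<open>m\<close>.

  The second is that the dipoles and the projection onto \<open>Fin\<close>, defined by their characteristic
  properties, exist. Both are Riesz representers, so a single theorem
  (\<open>riesz_representation\<close>) for functions with a complete semi-inner product is applied to the
  functions of finite energy and to the functions whose class lies in \<open>Fin\<close>. Completeness of the
  former follows from the connectedness of the network and a Fatou argument, and the latter are
  closed in the former.\<close>

section \<open>Semi-inner products on spaces of functions\<close>

text \<open>A quadratic polynomial that is non-negative everywhere has a non-positive discriminant; the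
  degenerate case \<open>c = 0\<close> forces \<open>b = 0\<close>.\<close>
lemma discriminant_le:
  fixes a b c :: real
  assumes "\<And>t. 0 \<le> a + 2 * t * b + t\<^sup>2 * c" and "0 \<le> c"
  shows "b\<^sup>2 \<le> a * c"
proof (cases "c = 0")
  case True
  have "b = 0"
  proof (rule ccontr)
    assume "b \<noteq> 0"
    then show False using assms(1)[of "- (a + 1) / (2 * b)"] True by (simp add: field_simps)
  qed
  then show ?thesis using True by simp
next
  case False
  then have "c > 0" using assms(2) by simp
  have "0 \<le> c * (a + 2 * (- b / c) * b + (- b / c)\<^sup>2 * c)"
    using assms by (intro mult_nonneg_nonneg)
  also have "\<dots> = a * c - b\<^sup>2"
    using \<open>c > 0\<close> by (simp add: field_simps power2_eq_square)
  finally show ?thesis by simp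
qed

text \<open>The form may vanish on nonzero functions: the energy form does so on the constants. Estimates
  are therefore made for functions, and carried over to classes modulo constants afterwards.
  The single operation \<open>u + t v\<close> encodes both addition and scaling.\<close>
locale semi_inner =
  fixes V :: "('a \<Rightarrow> real) set" and B :: "('a \<Rightarrow> real) \<Rightarrow> ('a \<Rightarrow> real) \<Rightarrow> real"
  assumes nonempty: "V \<noteq> {}"
    and comb: "\<lbrakk>u \<in> V; v \<in> V\<rbrakk> \<Longrightarrow> (\<lambda>x. u x + t * v x) \<in> V"
    and sym: "B u v = B v u"
    and linear_left: "\<lbrakk>u \<in> V; v \<in> V; w \<in> V\<rbrakk> \<Longrightarrow> B (\<lambda>x. u x + t * v x) w = B u w + t * B v w"
    and pos: "u \<in> V \<Longrightarrow> 0 \<le> B u u"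
begin

definition seminorm :: "('a \<Rightarrow> real) \<Rightarrow> real" where
  "seminorm u = sqrt (B u u)"

lemma zero_mem: "(\<lambda>x. 0) \<in> V"
proof -
  obtain u where "u \<in> V" using nonempty by blast
  from comb[OF this this, of "-1"] show ?thesis by simp
qed

lemma scale_mem: "u \<in> V \<Longrightarrow> (\<lambda>x. t * u x) \<in> V"
  using comb[OF zero_mem, of u t] by simp

lemma add_mem: "u \<in> V \<Longrightarrow> v \<in> V \<Longrightarrow> (\<lambda>x. u x + v x) \<in> V"
  using comb[of u v 1] by simp

lemma diff_mem: "u \<in> V \<Longrightarrow> v \<in> V \<Longrightarrow> (\<lambda>x. u x - v x) \<in> V"
  using comb[of u v "-1"] by simp

lemma linear_right:
  "\<lbrakk>u \<in> V; v \<in> V; w \<in> V\<rbrakk> \<Longrightarrow> B w (\<lambda>x. u x + t * v x) = B w u + t * B w v"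
  using linear_left[of u v w t] by (simp only: sym[of w])

lemma diff_left: "\<lbrakk>u \<in> V; v \<in> V; w \<in> V\<rbrakk> \<Longrightarrow> B (\<lambda>x. u x - v x) w = B u w - B v w"
  using linear_left[of u v w "-1"] by simp

lemma form_comb:
  assumes "u \<in> V" "v \<in> V"
  shows "B (\<lambda>x. u x + t * v x) (\<lambda>x. u x + t * v x) = B u u + 2 * t * B u v + t\<^sup>2 * B v v"
  using assms comb[OF assms, of t]
  by (simp add: linear_left linear_right sym[of v u] algebra_simps power2_eq_square)

lemma form_scale:
  assumes "u \<in> V"
  shows "B (\<lambda>x. t * u x) (\<lambda>x. t * u x) = t\<^sup>2 * B u u"
  using form_comb[OF assms assms, of "t - 1"]
  by (simp add: algebra_simps power2_eq_square)

lemma Cauchy_Schwarz_square: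
  assumes "u \<in> V" "v \<in> V"
  shows "(B u v)\<^sup>2 \<le> B u u * B v v"
proof (rule discriminant_le)
  fix t
  show "0 \<le> B u u + 2 * t * B u v + t\<^sup>2 * B v v"
    using pos[OF comb[OF assms, of t]] form_comb[OF assms, of t] by simp
qed (use assms pos in auto)

lemma Cauchy_Schwarz: "u \<in> V \<Longrightarrow> v \<in> V \<Longrightarrow> \<bar>B u v\<bar> \<le> seminorm u * seminorm v"
  using real_sqrt_le_mono[OF Cauchy_Schwarz_square[of u v]]
  by (simp add: seminorm_def real_sqrt_mult)

lemma seminorm_nonneg: "u \<in> V \<Longrightarrow> 0 \<le> seminorm u"
  by (simp add: seminorm_def pos)

lemma seminorm_square: "u \<in> V \<Longrightarrow> (seminorm u)\<^sup>2 = B u u"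
  by (simp add: seminorm_def pos)

lemma seminorm_scale: "u \<in> V \<Longrightarrow> seminorm (\<lambda>x. t * u x) = \<bar>t\<bar> * seminorm u"
  by (simp add: seminorm_def form_scale real_sqrt_mult)

lemma triangle:
  assumes "u \<in> V" "v \<in> V"
  shows "seminorm (\<lambda>x. u x + v x) \<le> seminorm u + seminorm v"
proof (rule power2_le_imp_le)
  have "(seminorm (\<lambda>x. u x + v x))\<^sup>2 = B u u + 2 * B u v + B v v"
    using seminorm_square[OF add_mem[OF assms]] form_comb[OF assms, of 1] by simp
  also have "\<dots> \<le> (seminorm u)\<^sup>2 + 2 * (seminorm u * seminorm v) + (seminorm v)\<^sup>2"
    using Cauchy_Schwarz[OF assms] assms by (simp add: seminorm_square)
  also have "\<dots> = (seminorm u + seminorm v)\<^sup>2"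
    by (simp add: power2_eq_square algebra_simps)
  finally show "(seminorm (\<lambda>x. u x + v x))\<^sup>2 \<le> (seminorm u + seminorm v)\<^sup>2" .
qed (use assms seminorm_nonneg in auto)

lemma triangle_diff:
  assumes "u \<in> V" "v \<in> V" "w \<in> V"
  shows "seminorm (\<lambda>x. u x - w x) \<le> seminorm (\<lambda>x. u x - v x) + seminorm (\<lambda>x. v x - w x)"
  using triangle[OF diff_mem[OF assms(1,2)] diff_mem[OF assms(2,3)]] by simp

lemma seminorm_minus_commute:
  assumes "u \<in> V" "v \<in> V"
  shows "seminorm (\<lambda>x. u x - v x) = seminorm (\<lambda>x. v x - u x)"
  using seminorm_scale[OF diff_mem[OF assms], of "-1"] by simp

definition Cauchy_seq :: "(nat \<Rightarrow> 'a \<Rightarrow> real) \<Rightarrow> bool" where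
  "Cauchy_seq s \<longleftrightarrow> (\<forall>n. s n \<in> V) \<and>
     (\<forall>e>0. \<exists>M. \<forall>m\<ge>M. \<forall>n\<ge>M. seminorm (\<lambda>x. s m x - s n x) \<le> e)"

lemma inner_tendsto:
  assumes "\<And>n. s n \<in> V" "l \<in> V" "w \<in> V" "(\<lambda>n. seminorm (\<lambda>x. s n x - l x)) \<longlonglongrightarrow> 0"
  shows "(\<lambda>n. B (s n) w) \<longlonglongrightarrow> B l w"
proof -
  have "(\<lambda>n. B (s n) w - B l w) \<longlonglongrightarrow> 0"
  proof (rule Lim_null_comparison)
    show "\<forall>\<^sub>F n in sequentially.
        norm (B (s n) w - B l w) \<le> seminorm (\<lambda>x. s n x - l x) * seminorm w"
      using Cauchy_Schwarz[OF diff_mem[OF assms(1,2)] assms(3)] diff_left assms by simp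
    show "(\<lambda>n. seminorm (\<lambda>x. s n x - l x) * seminorm w) \<longlonglongrightarrow> 0"
      using tendsto_mult_right[OF assms(4)] by simp
  qed
  then show ?thesis by (simp add: LIM_zero_iff)
qed

text \<open>The representer is obtained by minimising \<open>J(u) = B(u, u) - 2 L(u)\<close>: a minimising sequence is
  Cauchy by the parallelogram identity, and the first-order condition at its limit is
  \<open>B(f, w) = L(w)\<close>.\<close>
theorem riesz_representation:
  assumes complete: "\<And>s. Cauchy_seq s \<Longrightarrow> \<exists>l\<in>V. (\<lambda>n. seminorm (\<lambda>x. s n x - l x)) \<longlonglongrightarrow> 0"
    and lin: "\<And>u v t. \<lbrakk>u \<in> V; v \<in> V\<rbrakk> \<Longrightarrow> L (\<lambda>x. u x + t * v x) = L u + t * L v"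
    and bd: "\<And>u. u \<in> V \<Longrightarrow> \<bar>L u\<bar> \<le> C * seminorm u"
  shows "\<exists>f\<in>V. \<forall>w\<in>V. B f w = L w"
proof -
  define J where "J u = B u u - 2 * L u" for u
  have J_comb: "J (\<lambda>x. u x + t * v x) = J u + 2 * t * (B u v - L v) + t\<^sup>2 * B v v"
    if "u \<in> V" "v \<in> V" for u v t
    using that by (simp add: J_def form_comb lin algebra_simps)
  have J_lower: "- C\<^sup>2 \<le> J u" if "u \<in> V" for u
  proof -
    have "0 \<le> (seminorm u - C)\<^sup>2" by simp
    also have "\<dots> = B u u - 2 * (C * seminorm u) + C\<^sup>2"
      using seminorm_square[OF that] by (simp add: power2_eq_square algebra_simps)
    also have "\<dots> \<le> J u + C\<^sup>2" using bd[OF that] by (simp add: J_def)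
    finally show ?thesis by simp
  qed
  define d where "d = Inf (J ` V)"
  have d_le: "d \<le> J u" if "u \<in> V" for u
    unfolding d_def using that J_lower by (intro cInf_lower bdd_belowI2) auto
  have "\<exists>u\<in>V. J u < d + 1 / real (Suc n)" for n
    using cInf_lessD[of "J ` V" "d + 1 / real (Suc n)"] nonempty by (auto simp: d_def)
  then obtain s where s: "\<And>n. s n \<in> V" "\<And>n. J (s n) < d + 1 / real (Suc n)"
    by metis
  \<comment> \<open>The parallelogram identity in disguise: \<open>J\<close> is compared at \<open>s m\<close>, at \<open>s n\<close> and at their midpoint.\<close>
  have close: "(seminorm (\<lambda>x. s m x - s n x))\<^sup>2 \<le> 2 / real (Suc m) + 2 / real (Suc n)" for m n
  proof -
    let ?w = "\<lambda>x. s n x - s m x"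
    have w: "?w \<in> V" by (intro diff_mem s)
    have half: "d \<le> J (s m) + (B (s m) ?w - L ?w) + B ?w ?w / 4"
      using J_comb[OF s(1) w, of m "1/2"] d_le[OF comb[OF s(1) w, of m "1/2"]]
      by (simp add: power2_eq_square)
    have full: "J (s n) = J (s m) + 2 * (B (s m) ?w - L ?w) + B ?w ?w"
      using J_comb[OF s(1) w, of m 1] by simp
    have "(seminorm (\<lambda>x. s m x - s n x))\<^sup>2 = B ?w ?w"
      using seminorm_minus_commute[OF s(1) s(1), of m n] seminorm_square[OF w] by simp
    then show ?thesis using half full s(2)[of m] s(2)[of n] by argo
  qed
  have "Cauchy_seq s"
    unfolding Cauchy_seq_def
  proof (intro conjI allI impI)
    fix e :: real assume e: "e > 0"
    obtain M where M: "1 / real (Suc M) < e\<^sup>2 / 4"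
      using reals_Archimedean[of "e\<^sup>2 / 4"] e by (auto simp: inverse_eq_divide)
    have "seminorm (\<lambda>x. s m x - s n x) \<le> e" if "m \<ge> M" "n \<ge> M" for m n
    proof (rule power2_le_imp_le)
      have "1 / real (Suc m) \<le> 1 / real (Suc M)" "1 / real (Suc n) \<le> 1 / real (Suc M)"
        using that by (auto intro!: divide_left_mono)
      then show "(seminorm (\<lambda>x. s m x - s n x))\<^sup>2 \<le> e\<^sup>2"
        using close[of m n] M by argo
    qed (use e in simp)
    then show "\<exists>M. \<forall>m\<ge>M. \<forall>n\<ge>M. seminorm (\<lambda>x. s m x - s n x) \<le> e" by blast
  qed (rule s)
  then obtain l where l: "l \<in> V" "(\<lambda>n. seminorm (\<lambda>x. s n x - l x)) \<longlonglongrightarrow> 0"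
    using complete by blast
  have "B l w = L w" if w: "w \<in> V" for w
  proof -
    \<comment> \<open>An almost minimiser satisfies the first-order condition up to an error that tends to 0.\<close>
    have small: "(B (s n) w - L w)\<^sup>2 \<le> 1 / real (Suc n) * B w w" for n
    proof (rule discriminant_le)
      fix t
      show "0 \<le> 1 / real (Suc n) + 2 * t * (B (s n) w - L w) + t\<^sup>2 * B w w"
        using d_le[OF comb[OF s(1) w, of n t]] J_comb[OF s(1) w, of n t] s(2)[of n] by linarith
    qed (rule pos[OF w])
    have "(\<lambda>n. 1 / real (Suc n) * B w w) \<longlonglongrightarrow> 0"
      using tendsto_mult_right[OF LIMSEQ_inverse_real_of_nat, of "B w w"]
      by (simp add: inverse_eq_divide)
    then have "(\<lambda>n. (B (s n) w - L w)\<^sup>2) \<longlonglongrightarrow> 0"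
      by (rule Lim_null_comparison[rotated]) (use small in simp)
    then have "(\<lambda>n. B (s n) w - L w) \<longlonglongrightarrow> 0"
      using tendsto_real_sqrt[of "\<lambda>n. (B (s n) w - L w)\<^sup>2" 0] by (simp add: tendsto_rabs_zero_iff)
    then have "(\<lambda>n. B (s n) w) \<longlonglongrightarrow> L w"
      by (simp add: LIM_zero_iff)
    then show ?thesis
      using LIMSEQ_unique inner_tendsto[OF s(1) l(1) w l(2)] by blast
  qed
  then show ?thesis using l(1) by blast
qed

end

lemma semi_inner_subspace:
  assumes "semi_inner V B" "W \<subseteq> V" "W \<noteq> {}"
    and "\<And>u v t. u \<in> W \<Longrightarrow> v \<in> W \<Longrightarrow> (\<lambda>x. u x + t * v x) \<in> W"
  shows "semi_inner W B"
proof -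
  interpret semi_inner V B by fact
  show ?thesis using assms(2-) by unfold_locales (auto simp: linear_left pos subset_iff intro: sym)
qed

section \<open>Square-summable families of functionals\<close>

lemma summable_on_mult_of_squares:
  fixes f g :: "'i \<Rightarrow> real"
  assumes "(\<lambda>i. f i * f i) summable_on A" "(\<lambda>i. g i * g i) summable_on A"
  shows "(\<lambda>i. f i * g i) summable_on A"
proof -
  have "(\<lambda>i. norm (f i * f i + g i * g i)) summable_on A"
    using summable_on_add[OF assms] by simp
  then have "(\<lambda>i. norm (f i * g i)) summable_on A"
  proof (rule Infinite_Sum.abs_summable_on_comparison_test)
    fix i
    have "0 \<le> (\<bar>f i\<bar> - \<bar>g i\<bar>)\<^sup>2 + (f i * f i + g i * g i)" by simp
    also have "\<dots> = 2 * (f i * f i + g i * g i) - 2 * \<bar>f i * g i\<bar>"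
      by (simp add: power2_eq_square algebra_simps abs_mult)
    finally show "norm (f i * g i) \<le> norm (f i * f i + g i * g i)" by simp
  qed
  then show ?thesis by (rule abs_summable_summable)
qed

text \<open>Both forms of interest are sums \<open>\<Sum>\<^sub>i L\<^sub>i(u) L\<^sub>i(v)\<close> over a family of linear functionals: point
  evaluations give the inner product of \<open>\<ell>\<^sup>2\<close>, weighted differences along edges give the energy.\<close>
locale functional_family =
  fixes L :: "'i \<Rightarrow> ('a \<Rightarrow> real) \<Rightarrow> real"
  assumes lin: "L i (\<lambda>x. u x + t * v x) = L i u + t * L i v"
begin

definition sq_dom :: "('a \<Rightarrow> real) set" where
  "sq_dom = {u. (\<lambda>i. L i u * L i u) summable_on UNIV}"

definition sq_form :: "('a \<Rightarrow> real) \<Rightarrow> ('a \<Rightarrow> real) \<Rightarrow> real" where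
  "sq_form u v = (\<Sum>\<^sub>\<infinity>i. L i u * L i v)"

lemma summable_products: "u \<in> sq_dom \<Longrightarrow> v \<in> sq_dom \<Longrightarrow> (\<lambda>i. L i u * L i v) summable_on UNIV"
  by (auto simp: sq_dom_def intro: summable_on_mult_of_squares)

lemma functional_diff: "L i (\<lambda>x. u x - v x) = L i u - L i v"
  using lin[of i u "-1" v] by simp

sublocale semi_inner sq_dom sq_form
proof
  show "sq_dom \<noteq> {}"
  proof -
    have "L i (\<lambda>x. 0) = 0" for i using lin[of i "\<lambda>x. 0" 1 "\<lambda>x. 0"] by simp
    then have "(\<lambda>x. 0) \<in> sq_dom" by (simp add: sq_dom_def)
    then show ?thesis by blast
  qed
  show "(\<lambda>x. u x + t * v x) \<in> sq_dom" if "u \<in> sq_dom" "v \<in> sq_dom" for u v t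
  proof -
    have "(\<lambda>i. (L i u * L i u + t * (L i u * L i v)) + (t * (L i v * L i u) + t * t * (L i v * L i v)))
        summable_on UNIV"
      using that by (intro summable_on_add summable_on_cmult_right summable_products)
    then show ?thesis by (simp add: sq_dom_def lin algebra_simps)
  qed
  show "sq_form u v = sq_form v u" for u v by (simp add: sq_form_def mult.commute)
  show "sq_form (\<lambda>x. u x + t * v x) w = sq_form u w + t * sq_form v w"
    if "u \<in> sq_dom" "v \<in> sq_dom" "w \<in> sq_dom" for u v w t
    using that summable_products
    by (simp add: sq_form_def lin distrib_right mult.assoc infsum_add infsum_cmult_right
        summable_on_cmult_right)
  show "0 \<le> sq_form u u" for u
    by (simp add: sq_form_def infsum_nonneg)
qed

lemma functional_bound:
  assumes "u \<in> sq_dom"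
  shows "\<bar>L i u\<bar> \<le> seminorm u"
proof -
  have "(\<Sum>j\<in>{i}. L j u * L j u) \<le> sq_form u u"
    unfolding sq_form_def using summable_products[OF assms assms]
    by (intro finite_sum_le_infsum) auto
  then show ?thesis
    using real_sqrt_le_mono[of "(L i u)\<^sup>2" "sq_form u u"]
    by (simp add: seminorm_def power2_eq_square)
qed

text \<open>Fatou's lemma for sums: a Cauchy sequence that converges in every coordinate \<open>L\<^sub>i\<close> also converges
  in the seminorm, because finite partial sums pass to the limit and the bounds on them are uniform.\<close>
lemma Cauchy_seq_tendsto:
  assumes s: "Cauchy_seq s" and lim: "\<And>i. (\<lambda>n. L i (s n)) \<longlonglongrightarrow> L i l"
  shows "l \<in> sq_dom" "(\<lambda>n. seminorm (\<lambda>x. s n x - l x)) \<longlonglongrightarrow> 0"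
proof -
  have sV: "s n \<in> sq_dom" for n using s by (simp add: Cauchy_seq_def)
  have key: "\<exists>M. \<forall>n\<ge>M. (\<lambda>x. s n x - l x) \<in> sq_dom \<and> seminorm (\<lambda>x. s n x - l x) \<le> e"
    if e: "e > 0" for e
  proof -
    obtain M where M: "\<And>m n. m \<ge> M \<Longrightarrow> n \<ge> M \<Longrightarrow> seminorm (\<lambda>x. s n x - s m x) \<le> e"
      using s e unfolding Cauchy_seq_def by blast
    have "(\<lambda>x. s n x - l x) \<in> sq_dom \<and> seminorm (\<lambda>x. s n x - l x) \<le> e" if n: "n \<ge> M" for n
    proof -
      let ?d = "\<lambda>m i. (L i (s n) - L i (s m))\<^sup>2" and ?f = "\<lambda>i. (L i (s n) - L i l)\<^sup>2"
      have fin: "sum ?f F \<le> e\<^sup>2" if "finite F" for F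
      proof (rule tendsto_upperbound)
        show "(\<lambda>m. sum (?d m) F) \<longlonglongrightarrow> sum ?f F"
          by (intro tendsto_intros lim)
        have "sum (?d m) F \<le> e\<^sup>2" if m: "m \<ge> M" for m
        proof -
          have mem: "(\<lambda>x. s n x - s m x) \<in> sq_dom" by (intro diff_mem sV)
          have "sum (?d m) F \<le> sq_form (\<lambda>x. s n x - s m x) (\<lambda>x. s n x - s m x)"
            unfolding sq_form_def power2_eq_square functional_diff[symmetric]
            using summable_products[OF mem mem] \<open>finite F\<close> by (intro finite_sum_le_infsum) auto
          also have "\<dots> = (seminorm (\<lambda>x. s n x - s m x))\<^sup>2"
            by (simp add: seminorm_square[OF mem])
          also have "\<dots> \<le> e\<^sup>2"
            using M[OF m n] seminorm_nonneg[OF mem] by (intro power_mono)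
          finally show ?thesis .
        qed
        then show "\<forall>\<^sub>F m in sequentially. sum (?d m) F \<le> e\<^sup>2"
          by (auto simp: eventually_sequentially)
      qed simp
      have sum: "?f summable_on UNIV"
        using fin by (intro nonneg_bdd_above_summable_on bdd_aboveI2) auto
      have "infsum ?f UNIV \<le> e\<^sup>2"
        using fin by (intro infsum_le_finite_sums[OF sum]) auto
      then have "seminorm (\<lambda>x. s n x - l x) \<le> e"
        using real_sqrt_le_mono[of "infsum ?f UNIV" "e\<^sup>2"] e
        by (simp add: seminorm_def sq_form_def functional_diff power2_eq_square)
      then show ?thesis
        using sum by (simp add: sq_dom_def functional_diff power2_eq_square)
    qed
    then show ?thesis by blast
  qed
  obtain n where n: "(\<lambda>x. s n x - l x) \<in> sq_dom" using key[of 1] by auto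
  show lV: "l \<in> sq_dom" using diff_mem[OF sV[of n] n] by simp
  show "(\<lambda>n. seminorm (\<lambda>x. s n x - l x)) \<longlonglongrightarrow> 0"
  proof (rule LIMSEQ_I)
    fix e :: real assume "e > 0"
    then obtain M where "\<forall>n\<ge>M. seminorm (\<lambda>x. s n x - l x) \<le> e / 2" using key[of "e / 2"] by auto
    then show "\<exists>M. \<forall>n\<ge>M. norm (seminorm (\<lambda>x. s n x - l x) - 0) < e"
      using \<open>e > 0\<close> seminorm_nonneg[OF diff_mem[OF sV lV]] by (intro exI[of _ M]) force
  qed
qed

end

section \<open>Square-summable and finitely supported functions\<close>

interpretation coordinates: functional_family "\<lambda>x (u :: 'a \<Rightarrow> real). u x"
  by unfold_locales simp

lemma coordinates_eq: "coordinates.sq_dom = l2" "coordinates.sq_form = l2_inner"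
  by (auto simp: coordinates.sq_dom_def l2_def coordinates.sq_form_def l2_inner_def fun_eq_iff)

interpretation l2: semi_inner "l2 :: ('a \<Rightarrow> real) set" l2_inner
  rewrites "semi_inner.seminorm l2_inner = (l2_norm :: ('a \<Rightarrow> real) \<Rightarrow> real)"
proof -
  show l2: "semi_inner (l2 :: ('a \<Rightarrow> real) set) l2_inner"
    using coordinates.semi_inner_axioms by (simp only: coordinates_eq)
  show "semi_inner.seminorm l2_inner = (l2_norm :: ('a \<Rightarrow> real) \<Rightarrow> real)"
    by (simp add: semi_inner.seminorm_def[OF l2] l2_norm_def fun_eq_iff)
qed

lemma finite_imp_l2: "finite {x. u x \<noteq> 0} \<Longrightarrow> u \<in> l2"
  unfolding l2_def mem_Collect_eq
  by (rule finite_nonzero_values_imp_summable_on) (auto elim: rev_finite_subset)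

lemma dirac_span_eq: "dirac_span = {u :: 'a \<Rightarrow> real. finite {x. u x \<noteq> 0}}"
proof (intro set_eqI iffI)
  fix u :: "'a \<Rightarrow> real"
  assume "u \<in> dirac_span"
  then obtain A a where u: "finite A" "u = (\<lambda>z. \<Sum>x\<in>A. a x * dirac x z)"
    unfolding dirac_span_def by blast
  have "{x. u x \<noteq> 0} \<subseteq> A"
    using u by (auto simp: dirac_def indicator_def elim!: sum.not_neutral_contains_not_neutral)
  then show "u \<in> {u. finite {x. u x \<noteq> 0}}" using u(1) finite_subset by blast
next
  fix u :: "'a \<Rightarrow> real"
  assume "u \<in> {u. finite {x. u x \<noteq> 0}}"
  then have fin: "finite {x. u x \<noteq> 0}" by simp
  have "u = (\<lambda>z. \<Sum>x\<in>{x. u x \<noteq> 0}. u x * dirac x z)"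
    using fin by (simp add: fun_eq_iff dirac_def indicator_def of_bool_def if_distrib cong: if_cong)
  then show "u \<in> dirac_span" unfolding dirac_span_def using fin by blast
qed

lemma dirac_span_comb:
  "u \<in> dirac_span \<Longrightarrow> v \<in> dirac_span \<Longrightarrow> (\<lambda>x. u x + t * v x) \<in> dirac_span"
  unfolding dirac_span_eq
  by (auto intro: finite_subset[of _ "{x. u x \<noteq> 0} \<union> {x. v x \<noteq> 0}"])

lemma dirac_mem_span: "dirac x \<in> dirac_span"
  by (auto simp: dirac_span_eq dirac_def indicator_def)

lemma dirac_span_l2: "dirac_span \<subseteq> l2"
  by (auto simp: dirac_span_eq finite_imp_l2)

lemma dirac_span_ne: "dirac_span \<noteq> {}"
  using dirac_mem_span[of undefined] by force

lemma point_difference_bound: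
  assumes "\<phi> \<in> l2"
  shows "(\<phi> x - \<phi> y)\<^sup>2 \<le> 2 * l2_inner \<phi> \<phi>"
proof (cases "x = y")
  case True
  then show ?thesis using l2.pos[OF assms] by simp
next
  case False
  have "(\<phi> x - \<phi> y)\<^sup>2 = 2 * (\<phi> x * \<phi> x + \<phi> y * \<phi> y) - (\<phi> x + \<phi> y)\<^sup>2"
    by (simp add: power2_eq_square algebra_simps)
  also have "\<dots> \<le> 2 * (\<phi> x * \<phi> x + \<phi> y * \<phi> y)" by simp
  also have "\<phi> x * \<phi> x + \<phi> y * \<phi> y = (\<Sum>z\<in>{x, y}. \<phi> z * \<phi> z)" using False by simp
  also have "\<dots> \<le> l2_inner \<phi> \<phi>"
    unfolding l2_inner_def using assms by (intro finite_sum_le_infsum) (auto simp: l2_def)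
  finally show ?thesis by simp
qed

section \<open>The energy form and the Laplacian\<close>

text \<open>Every edge occurs in both orientations among the pairs, whence the factor \<open>1/2\<close>.\<close>
definition edge_gradient :: "('a \<Rightarrow> 'a \<Rightarrow> real) \<Rightarrow> 'a \<times> 'a \<Rightarrow> ('a \<Rightarrow> real) \<Rightarrow> real" where
  "edge_gradient c = (\<lambda>(x, y) u. sqrt (c x y / 2) * (u x - u y))"

context network
begin

sublocale gradient: functional_family "edge_gradient c"
  by unfold_locales (auto simp: edge_gradient_def algebra_simps split: prod.split)

lemma edge_gradient_mult:
  "edge_gradient c p u * edge_gradient c p v
    = 1/2 * (case p of (x, y) \<Rightarrow> c x y * (u x - u y) * (v x - v y))"
proof -
  obtain x y where "p = (x, y)" by (cases p)
  moreover have "sqrt (c x y / 2) * sqrt (c x y / 2) = c x y / 2"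
    using nonneg by simp
  ultimately show ?thesis
    by (simp add: edge_gradient_def mult.assoc mult.left_commute flip: mult.assoc)
qed

lemma gradient_eq: "gradient.sq_dom = dom_energy c" "gradient.sq_form = energy c"
proof -
  show "gradient.sq_dom = dom_energy c"
    unfolding gradient.sq_dom_def dom_energy_def edge_gradient_mult
    by (subst summable_on_cmult_right') simp_all
  show "gradient.sq_form = energy c"
    unfolding gradient.sq_form_def energy_def edge_gradient_mult infsum_cmult_right' by simp
qed

sublocale E: semi_inner "dom_energy c" "energy c"
  using gradient.semi_inner_axioms by (simp only: gradient_eq)

text \<open>For a function supported in \<open>S\<close>, every edge with nonzero gradient joins two points of this set.\<close>
definition nbhd :: "'a set \<Rightarrow> 'a set" where
  "nbhd S = S \<union> (\<Union>x\<in>S. {y. c x y > 0})"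

lemma finite_nbhd: "finite S \<Longrightarrow> finite (nbhd S)"
  by (simp add: nbhd_def locally_finite)

lemma conductance_zero: "x \<in> S \<Longrightarrow> y \<notin> nbhd S \<Longrightarrow> c x y = 0"
  using nonneg[of x y] by (auto simp: nbhd_def not_less)

lemma laplacian_eq_sum:
  assumes "finite A" "\<And>y. y \<notin> A \<Longrightarrow> c x y = 0"
  shows "laplacian c u x = (\<Sum>y\<in>A. c x y * (u x - u y))"
  unfolding laplacian_def
proof (rule sum.mono_neutral_left)
  show "{y. c x y > 0} \<subseteq> A" using assms(2) by force
  show "\<forall>y\<in>A - {y. c x y > 0}. c x y * (u x - u y) = 0"
    using nonneg[of x] by (auto simp: not_less order.antisym)
qed (rule assms)

lemma laplacian_finite_support:
  assumes "u \<in> dirac_span"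
  shows "laplacian c u \<in> dirac_span"
proof -
  have "{x. laplacian c u x \<noteq> 0} \<subseteq> nbhd {x. u x \<noteq> 0}"
  proof
    fix x assume "x \<in> {x. laplacian c u x \<noteq> 0}"
    then obtain y where "c x y > 0" "u x - u y \<noteq> 0"
      by (auto simp: laplacian_def elim!: sum.not_neutral_contains_not_neutral)
    then show "x \<in> nbhd {x. u x \<noteq> 0}"
      using symmetric[of x y] by (auto simp: nbhd_def intro!: exI[of _ y])
  qed
  then show ?thesis
    using assms finite_nbhd finite_subset unfolding dirac_span_eq by blast
qed

lemma dirac_span_dom_energy: "dirac_span \<subseteq> dom_energy c"
proof
  fix u :: "'a \<Rightarrow> real" assume u: "u \<in> dirac_span"
  let ?A = "nbhd {x. u x \<noteq> 0}"
  have "{p \<in> UNIV. (case p of (x, y) \<Rightarrow> c x y * (u x - u y) * (u x - u y)) \<noteq> 0} \<subseteq> ?A \<times> ?A"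
    using conductance_zero[of _ "{x. u x \<noteq> 0}"] symmetric
    by (auto simp: nbhd_def) (metis less_eq_real_def nonneg)+
  then show "u \<in> dom_energy c"
    unfolding dom_energy_def mem_Collect_eq
    using u finite_nbhd[of "{x. u x \<noteq> 0}"]
    by (intro finite_nonzero_values_imp_summable_on)
       (auto simp: dirac_span_eq intro: finite_subset)
qed

text \<open>Summation by parts. Both functions are supported in a finite set \<open>S\<close>, so the double sum reduces
  to \<open>A \<times> A\<close> with \<open>A\<close> the closed neighbourhood of \<open>S\<close>; exchanging \<open>x\<close> and \<open>y\<close> turns the half that
  contains \<open>v(y)\<close> into the half that contains \<open>v(x)\<close>.\<close>
lemma green_identity:
  assumes "u \<in> dirac_span" "v \<in> dirac_span"
  shows "energy c u v = l2_inner (laplacian c u) v"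
proof -
  define S where "S = {x. u x \<noteq> 0} \<union> {x. v x \<noteq> 0}"
  define A where "A = nbhd S"
  have fin: "finite S" "finite A"
    using assms finite_nbhd by (auto simp: S_def A_def dirac_span_eq)
  have out: "c x y = 0 \<or> u x - u y = 0" if "x \<notin> A \<or> y \<notin> A" for x y
  proof -
    have "c x y = 0" if "x \<in> S \<or> y \<in> S"
      using that \<open>x \<notin> A \<or> y \<notin> A\<close> conductance_zero[of x S y] conductance_zero[of y S x] symmetric[of x y]
      unfolding A_def by (auto simp: nbhd_def)
    then show ?thesis by (auto simp: S_def)
  qed
  have "(\<Sum>\<^sub>\<infinity>(x, y). c x y * (u x - u y) * (v x - v y))
      = (\<Sum>\<^sub>\<infinity>(x, y)\<in>A \<times> A. c x y * (u x - u y) * (v x - v y))"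
    using out by (intro infsum_cong_neutral) force+
  also have "\<dots> = (\<Sum>x\<in>A. \<Sum>y\<in>A. c x y * (u x - u y) * (v x - v y))"
    using fin by (simp add: sum.cartesian_product)
  also have "\<dots> = (\<Sum>x\<in>A. \<Sum>y\<in>A. c x y * (u x - u y) * v x)
      - (\<Sum>x\<in>A. \<Sum>y\<in>A. c x y * (u x - u y) * v y)"
    by (simp add: right_diff_distrib sum_subtractf)
  also have "(\<Sum>x\<in>A. \<Sum>y\<in>A. c x y * (u x - u y) * v y)
      = (\<Sum>y\<in>A. \<Sum>x\<in>A. c x y * (u x - u y) * v y)"
    by (rule sum.swap)
  also have "\<dots> = - (\<Sum>y\<in>A. \<Sum>x\<in>A. c y x * (u y - u x) * v y)"
    unfolding sum_negf[symmetric] using symmetric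
    by (intro sum.cong refl) (simp add: algebra_simps)
  finally have "energy c u v = (\<Sum>x\<in>A. \<Sum>y\<in>A. c x y * (u x - u y) * v x)"
    by (simp add: energy_def)
  also have "\<dots> = (\<Sum>x\<in>S. \<Sum>y\<in>A. c x y * (u x - u y) * v x)"
    using fin by (intro sum.mono_neutral_right) (auto simp: A_def nbhd_def S_def)
  also have "\<dots> = (\<Sum>x\<in>S. laplacian c u x * v x)"
  proof (rule sum.cong)
    fix x assume "x \<in> S"
    then show "(\<Sum>y\<in>A. c x y * (u x - u y) * v x) = laplacian c u x * v x"
      using laplacian_eq_sum[OF fin(2), of x u] conductance_zero
      by (simp add: A_def sum_distrib_right)
  qed simp
  also have "\<dots> = (\<Sum>\<^sub>\<infinity>x\<in>S. laplacian c u x * v x)" using fin by simp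
  also have "\<dots> = l2_inner (laplacian c u) v"
    unfolding l2_inner_def by (intro infsum_cong_neutral) (auto simp: S_def)
  finally show ?thesis .
qed

section \<open>The bottom of the spectrum\<close>

text \<open>The resolvent \<open>(\<Delta>\<^sub>2 - r)\<^sup>-\<^sup>1 \<phi>\<close> need not be finitely supported, but it lies in the domain of a
  closure and is approximated, together with its image, by finitely supported \<open>\<psi>\<close>. In this form the
  bounded inverse can be used while all operators act on finitely supported functions.\<close>
lemma resolvent_approximation:
  assumes r: "r \<in> resolvent_set (laplacian2 c)"
  obtains C where "\<And>\<phi> e. \<phi> \<in> dirac_span \<Longrightarrow> 0 < e \<Longrightarrow> \<exists>\<psi>\<in>dirac_span.
    l2_norm \<psi> \<le> C * l2_norm \<phi> + e \<and>
    l2_norm (\<lambda>x. laplacian c \<psi> x - r * \<psi> x - \<phi> x) \<le> e"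
proof -
  obtain C where solve: "\<And>f. f \<in> l2 \<Longrightarrow> \<exists>u w. (u, w) \<in> laplacian2 c \<and> (\<lambda>x. w x - r * u x) = f"
    and bd: "\<And>u w. (u, w) \<in> laplacian2 c \<Longrightarrow> l2_norm u \<le> C * l2_norm (\<lambda>x. w x - r * u x)"
    using r unfolding resolvent_set_def by blast
  note tri = l2.triangle and scale = l2.seminorm_scale
    and diff = l2.diff_mem and scm = l2.scale_mem
  have "\<exists>\<psi>\<in>dirac_span. l2_norm \<psi> \<le> C * l2_norm \<phi> + e \<and>
      l2_norm (\<lambda>x. laplacian c \<psi> x - r * \<psi> x - \<phi> x) \<le> e"
    if \<phi>: "\<phi> \<in> dirac_span" and e: "0 < e" for \<phi> e
  proof -
    obtain u w where uw: "(u, w) \<in> laplacian2 c" "(\<lambda>x. w x - r * u x) = \<phi>"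
      using solve dirac_span_l2 \<phi> by blast
    then obtain \<psi> where mem: "u \<in> l2" "w \<in> l2" and \<psi>: "\<And>n. \<psi> n \<in> dirac_span"
      "(\<lambda>n. l2_norm (\<lambda>x. \<psi> n x - u x)) \<longlonglongrightarrow> 0"
      "(\<lambda>n. l2_norm (\<lambda>x. laplacian c (\<psi> n) x - w x)) \<longlonglongrightarrow> 0"
      unfolding laplacian2_def by blast
    define \<delta> where "\<delta> = e / (1 + \<bar>r\<bar>)"
    have \<delta>: "\<delta> > 0" "\<delta> \<le> e" "\<delta> + \<bar>r\<bar> * \<delta> = e"
    proof -
      have r: "1 + \<bar>r\<bar> > 0" by (simp add: add_pos_nonneg)
      have e_eq: "e = \<delta> * (1 + \<bar>r\<bar>)" using r by (simp add: \<delta>_def)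
      show "\<delta> > 0" using e r by (simp add: \<delta>_def)
      then show "\<delta> \<le> e" "\<delta> + \<bar>r\<bar> * \<delta> = e" by (simp_all add: e_eq algebra_simps)
    qed
    have "\<forall>\<^sub>F n in sequentially. l2_norm (\<lambda>x. \<psi> n x - u x) < \<delta> \<and>
        l2_norm (\<lambda>x. laplacian c (\<psi> n) x - w x) < \<delta>"
      using \<psi>(2,3) \<delta>(1) by (intro eventually_conj order_tendstoD(2))
    then obtain n where n: "l2_norm (\<lambda>x. \<psi> n x - u x) < \<delta>"
        "l2_norm (\<lambda>x. laplacian c (\<psi> n) x - w x) < \<delta>"
      by (auto simp: eventually_sequentially)
    have l2: "\<psi> n \<in> l2" "laplacian c (\<psi> n) \<in> l2"
      using \<psi>(1) laplacian_finite_support dirac_span_l2 by blast+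
    have d1: "(\<lambda>x. \<psi> n x - u x) \<in> l2" and d2: "(\<lambda>x. laplacian c (\<psi> n) x - w x) \<in> l2"
      using l2 mem diff by blast+
    have "l2_norm (\<psi> n) \<le> l2_norm u + l2_norm (\<lambda>x. \<psi> n x - u x)"
      using tri[OF mem(1) d1] by simp
    then have 1: "l2_norm (\<psi> n) \<le> C * l2_norm \<phi> + e"
      using bd[OF uw(1)] n \<delta> uw(2) by simp
    have "laplacian c (\<psi> n) x - r * \<psi> n x - \<phi> x
        = (laplacian c (\<psi> n) x - w x) + (- r) * (\<psi> n x - u x)" for x
      unfolding uw(2)[symmetric] by (simp add: algebra_simps)
    then have "l2_norm (\<lambda>x. laplacian c (\<psi> n) x - r * \<psi> n x - \<phi> x)
        \<le> l2_norm (\<lambda>x. laplacian c (\<psi> n) x - w x) + l2_norm (\<lambda>x. (- r) * (\<psi> n x - u x))"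
      using tri[OF d2 scm[OF d1, of "- r"]] by (simp only:)
    also have "\<dots> \<le> \<delta> + \<bar>r\<bar> * \<delta>"
      using n scale[OF d1, of "- r"] by (simp add: add_mono mult_left_mono)
    finally show ?thesis using 1 \<psi>(1) \<delta>(3) by blast
  qed
  then show ?thesis using that by blast
qed

text \<open>The infimum \<open>m\<close> of the Rayleigh quotients belongs to the spectrum. Otherwise some finitely
  supported \<open>\<psi>\<close> is close to \<open>(\<Delta>\<^sub>2 - m)\<^sup>-\<^sup>1 \<phi>\<close>, so that \<open>q(\<psi>, \<phi>) \<ge> \<parallel>\<phi>\<parallel>\<^sup>2 / 2\<close> and \<open>q(\<psi>, \<psi>)\<close> is at most a
  fixed multiple of \<open>\<parallel>\<phi>\<parallel>\<^sup>2\<close>; then \<open>q(\<psi>, \<phi>)\<^sup>2 \<le> q(\<psi>, \<psi>) q(\<phi>, \<phi>)\<close> bounds \<open>q(\<phi>, \<phi>) / \<parallel>\<phi>\<parallel>\<^sup>2\<close> away from 0, which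
  contradicts the choice of \<open>m\<close>.\<close>
lemma poincare_inequality:
  assumes spec: "spec (laplacian2 c) \<subseteq> {\<gamma>..}" and \<phi>: "\<phi> \<in> dirac_span"
  shows "\<gamma> * l2_inner \<phi> \<phi> \<le> energy c \<phi> \<phi>"
proof -
  define Q where "Q = {energy c \<phi> \<phi> / l2_inner \<phi> \<phi> | \<phi>. \<phi> \<in> dirac_span \<and> l2_inner \<phi> \<phi> > 0}"
  define m where "m = Inf Q"
  have bdd: "bdd_below Q"
    using dirac_span_dom_energy
    by (intro bdd_belowI[of _ 0]) (auto simp: Q_def intro!: divide_nonneg_pos E.pos)
  have m_le: "m * l2_inner u u \<le> energy c u u" if u: "u \<in> dirac_span" for u
  proof (cases "l2_inner u u > 0")
    case True
    then have "m \<le> energy c u u / l2_inner u u"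
      unfolding m_def using u by (intro cInf_lower bdd) (auto simp: Q_def)
    then show ?thesis using True by (simp add: field_simps)
  next
    case False
    then have "l2_inner u u = 0"
      using l2.pos[of u] u dirac_span_l2 by force
    then show ?thesis using E.pos[of u] u dirac_span_dom_energy by auto
  qed
  have "l2_inner (dirac x) (dirac x) = 1" for x :: 'a
  proof -
    have "l2_inner (dirac x) (dirac x) = (\<Sum>\<^sub>\<infinity>y\<in>{x}. 1)"
      unfolding l2_inner_def by (intro infsum_cong_neutral) (auto simp: dirac_def)
    then show ?thesis by simp
  qed
  then have Q_ne: "Q \<noteq> {}"
    using dirac_mem_span unfolding Q_def by (metis (mono_tags, lifting) empty_Collect_eq zero_less_one)
  have "m \<in> spec (laplacian2 c)"
  proof (rule ccontr)
    assume "m \<notin> spec (laplacian2 c)"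
    then have "m \<in> resolvent_set (laplacian2 c)" by (simp add: spec_def)
    then obtain C where C: "\<And>\<phi> e. \<phi> \<in> dirac_span \<Longrightarrow> 0 < e \<Longrightarrow> \<exists>\<psi>\<in>dirac_span.
      l2_norm \<psi> \<le> C * l2_norm \<phi> + e \<and> l2_norm (\<lambda>x. laplacian c \<psi> x - m * \<psi> x - \<phi> x) \<le> e"
      by (rule resolvent_approximation) blast
    define q where "q u v = energy c u v - m * l2_inner u v" for u v
    interpret q: semi_inner dirac_span q
    proof
      fix u v w :: "'a \<Rightarrow> real" and t
      show "dirac_span \<noteq> ({} :: ('a \<Rightarrow> real) set)" by (rule dirac_span_ne)
      show "q u v = q v u"
        using E.sym[of u v] l2.sym[of u v] by (simp add: q_def)
      assume u: "u \<in> dirac_span"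
      then show "0 \<le> q u u" using m_le by (simp add: q_def)
      assume v: "v \<in> dirac_span"
      then show "(\<lambda>x. u x + t * v x) \<in> dirac_span" using u by (intro dirac_span_comb)
      assume w: "w \<in> dirac_span"
      show "q (\<lambda>x. u x + t * v x) w = q u w + t * q v w"
      proof -
        have "energy c (\<lambda>x. u x + t * v x) w = energy c u w + t * energy c v w"
          using u v w dirac_span_dom_energy by (intro E.linear_left) auto
        moreover have "l2_inner (\<lambda>x. u x + t * v x) w = l2_inner u w + t * l2_inner v w"
          using u v w dirac_span_l2 by (intro l2.linear_left) auto
        ultimately show ?thesis by (simp add: q_def algebra_simps)
      qed
    qed
    \<comment> \<open>From \<open>(b\<^sup>2/2)\<^sup>2 \<le> q \<psi> \<psi> * q \<phi> \<phi>\<close> and \<open>q \<psi> \<psi> \<le> (3/2) b * (\<bar>C\<bar> + 1/2) b\<close>, where \<open>b = \<parallel>\<phi>\<parallel>\<close>.\<close>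
    define K where "K = 6 * (\<bar>C\<bar> + 1 / 2)"
    have K: "K > 0" by (simp add: K_def)
    have coercive: "l2_inner \<phi> \<phi> \<le> K * q \<phi> \<phi>" if \<phi>: "\<phi> \<in> dirac_span" "l2_inner \<phi> \<phi> > 0" for \<phi>
    proof -
      define b where "b = l2_norm \<phi>"
      have b: "b > 0" "l2_inner \<phi> \<phi> = b\<^sup>2" using \<phi>(2) by (simp_all add: b_def l2_norm_def)
      \<comment> \<open>The relative error \<open>1/2\<close> suffices, since only some positive lower bound on the quotient is needed.\<close>
      obtain \<psi> where \<psi>: "\<psi> \<in> dirac_span" "l2_norm \<psi> \<le> C * b + b / 2"
        "l2_norm (\<lambda>x. laplacian c \<psi> x - m * \<psi> x - \<phi> x) \<le> b / 2"
        using C[OF \<phi>(1), of "b / 2"] b by (auto simp: b_def)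
      have l2: "\<phi> \<in> l2" "\<psi> \<in> l2" "laplacian c \<psi> \<in> l2"
        using \<phi> \<psi> dirac_span_l2 laplacian_finite_support by blast+
      define \<rho> where "\<rho> = (\<lambda>x. laplacian c \<psi> x - m * \<psi> x - \<phi> x)"
      have \<rho>: "\<rho> \<in> l2" "l2_norm \<rho> \<le> b / 2"
        unfolding \<rho>_def by (intro l2.diff_mem l2.scale_mem l2 \<psi>(3))+
      have q_eq: "q \<psi> v = l2_inner \<phi> v + l2_inner \<rho> v" if v: "v \<in> dirac_span" for v
      proof -
        have v2: "v \<in> l2" using v dirac_span_l2 by blast
        have "l2_inner \<rho> v = l2_inner (laplacian c \<psi>) v - l2_inner (\<lambda>x. m * \<psi> x) v - l2_inner \<phi> v"
          unfolding \<rho>_def using l2 v2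
          by (simp add: l2.diff_left l2.diff_mem l2.scale_mem)
        moreover have "l2_inner (\<lambda>x. m * \<psi> x) v = m * l2_inner \<psi> v"
          by (simp add: l2_inner_def mult.assoc infsum_cmult_right')
        ultimately show ?thesis using green_identity[OF \<psi>(1) v] by (simp add: q_def)
      qed
      note CS = l2.Cauchy_Schwarz
      have "\<bar>l2_inner \<rho> \<phi>\<bar> \<le> b / 2 * b"
        using CS[OF \<rho>(1) l2(1)] mult_right_mono[OF \<rho>(2), of b] b(1)
        unfolding b_def[symmetric] by linarith
      then have low: "b\<^sup>2 / 2 \<le> q \<psi> \<phi>"
        using q_eq[OF \<phi>(1)] b by (simp add: power2_eq_square abs_le_iff)
      have "q \<psi> \<psi> \<le> (b + b / 2) * l2_norm \<psi>"
      proof -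
        have "\<bar>l2_inner \<rho> \<psi>\<bar> \<le> b / 2 * l2_norm \<psi>"
          using CS[OF \<rho>(1) l2(2)] mult_right_mono[OF \<rho>(2) l2.seminorm_nonneg[OF l2(2)]]
          by simp
        moreover have "\<bar>l2_inner \<phi> \<psi>\<bar> \<le> b * l2_norm \<psi>" using CS[OF l2(1,2)] by (simp add: b_def)
        ultimately show ?thesis using q_eq[OF \<psi>(1)] by (simp add: algebra_simps)
      qed
      also have "\<dots> \<le> (b + b / 2) * (\<bar>C\<bar> * b + b / 2)"
        using b \<psi>(2) by (intro mult_left_mono) (auto intro: order_trans mult_right_mono)
      also have "\<dots> = b\<^sup>2 * (K / 4)" by (simp add: K_def power2_eq_square algebra_simps)
      finally have up: "q \<psi> \<psi> \<le> b\<^sup>2 * (K / 4)" .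
      have "b\<^sup>2 * (b\<^sup>2 / 4) = (b\<^sup>2 / 2)\<^sup>2" by (simp add: power2_eq_square)
      also have "\<dots> \<le> (q \<psi> \<phi>)\<^sup>2" using low by (intro power_mono) auto
      also have "\<dots> \<le> q \<psi> \<psi> * q \<phi> \<phi>" using q.Cauchy_Schwarz_square[OF \<psi>(1) \<phi>(1)] .
      also have "\<dots> \<le> b\<^sup>2 * (K / 4) * q \<phi> \<phi>" using up q.pos[OF \<phi>(1)] by (intro mult_right_mono)
      also have "\<dots> = b\<^sup>2 * (K * q \<phi> \<phi> / 4)" by simp
      finally have "b\<^sup>2 / 4 \<le> K * q \<phi> \<phi> / 4"
        using b(1) by (subst (asm) mult_le_cancel_left_pos) auto
      then show ?thesis using b(2) by simp
    qed
    have "m + 1 / K \<le> Inf Q"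
    proof (rule cInf_greatest[OF Q_ne])
      fix z assume "z \<in> Q"
      then obtain \<phi> where \<phi>: "\<phi> \<in> dirac_span" "l2_inner \<phi> \<phi> > 0" "z = energy c \<phi> \<phi> / l2_inner \<phi> \<phi>"
        unfolding Q_def by blast
      have "K * ((m + 1 / K) * l2_inner \<phi> \<phi>) \<le> K * energy c \<phi> \<phi>"
        using coercive[OF \<phi>(1,2)] K by (simp add: q_def algebra_simps)
      then have "(m + 1 / K) * l2_inner \<phi> \<phi> \<le> energy c \<phi> \<phi>"
        using K by (simp only: mult_le_cancel_left_pos)
      then show "m + 1 / K \<le> z" using \<phi>(2,3) by (simp only: pos_le_divide_eq)
    qed
    then show False using K by (simp add: m_def)
  qed
  then have "\<gamma> \<le> m" using spec by auto
  then have "\<gamma> * l2_inner \<phi> \<phi> \<le> m * l2_inner \<phi> \<phi>"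
    using l2.pos[of \<phi>] \<phi> dirac_span_l2 by (intro mult_right_mono) auto
  then show ?thesis using m_le[OF \<phi>] by simp
qed


section \<open>Completeness of the energy space\<close>

text \<open>The gradient along one edge is bounded by the energy; connectedness lets such bounds be added
  along a path. This makes evaluation of differences continuous, and shows that the functions of
  energy zero are the constants.\<close>
lemma oscillation_bound:
  obtains K where "\<And>u. u \<in> dom_energy c \<Longrightarrow> \<bar>u x - u y\<bar> \<le> K * E.seminorm u"
proof -
  have "\<exists>K. \<forall>u\<in>dom_energy c. \<bar>u x - u y\<bar> \<le> K * E.seminorm u"
    using connected[of x y]
  proof (induction rule: rtranclp_induct)
    case base
    show ?case by (rule exI[of _ 0]) simp
  next
    case (step y z)
    then obtain K where K: "\<And>u. u \<in> dom_energy c \<Longrightarrow> \<bar>u x - u y\<bar> \<le> K * E.seminorm u" by blast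
    define g where "g = sqrt (c y z / 2)"
    have g: "g > 0" using step by (simp add: g_def)
    have "\<bar>u x - u z\<bar> \<le> (K + 1 / g) * E.seminorm u" if u: "u \<in> dom_energy c" for u
    proof -
      have "g * \<bar>u y - u z\<bar> \<le> E.seminorm u"
        using gradient.functional_bound[unfolded gradient_eq, OF u, of "(y, z)"] g
        by (simp add: edge_gradient_def abs_mult flip: g_def)
      then have "\<bar>u y - u z\<bar> \<le> 1 / g * E.seminorm u" using g by (simp add: field_simps)
      then show ?thesis using K[OF u] unfolding distrib_right by linarith
    qed
    then show ?case by blast
  qed
  then show ?thesis using that by blast
qed

lemma energy_zero_imp_constant:
  assumes "u \<in> dom_energy c" "energy c u u = 0"
  shows "u x = u y"
  using oscillation_bound[of x y] assms by (metis E.seminorm_def abs_le_zero_iff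
      eq_iff_diff_eq_0 mult_zero_right real_sqrt_zero)

text \<open>The energy ignores constants, so a Cauchy sequence is first normalised to vanish at a base point
  \<open>b\<close>. It then converges pointwise, and Fatou's lemma upgrades this to convergence in energy.\<close>
lemma energy_complete:
  assumes s: "E.Cauchy_seq s"
  shows "\<exists>l\<in>dom_energy c. (\<lambda>n. E.seminorm (\<lambda>x. s n x - l x)) \<longlonglongrightarrow> 0"
proof -
  have mem: "s n \<in> dom_energy c" for n using s by (simp add: E.Cauchy_seq_def)
  \<comment> \<open>Any vertex serves as the base point.\<close>
  define b :: 'a where "b = undefined"
  have conv: "convergent (\<lambda>n. s n x - s n b)" for x
  proof -
    obtain K where K: "\<And>u. u \<in> dom_energy c \<Longrightarrow> \<bar>u x - u b\<bar> \<le> K * E.seminorm u"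
      using oscillation_bound[of x b] by blast
    have "Cauchy (\<lambda>n. s n x - s n b)"
    proof (rule CauchyI)
      fix e :: real assume e: "e > 0"
      define e' where "e' = e / (\<bar>K\<bar> + 1)"
      have e': "e' > 0" "\<bar>K\<bar> * e' < e"
        using e by (auto simp: e'_def field_simps add_pos_nonneg)
      obtain M where M: "\<And>m n. m \<ge> M \<Longrightarrow> n \<ge> M \<Longrightarrow> E.seminorm (\<lambda>x. s m x - s n x) \<le> e'"
        using s e' unfolding E.Cauchy_seq_def by blast
      have "norm ((s m x - s m b) - (s n x - s n b)) < e" if mn: "m \<ge> M" "n \<ge> M" for m n
      proof -
        have d: "(\<lambda>x. s m x - s n x) \<in> dom_energy c" by (intro E.diff_mem mem)
        have "norm ((s m x - s m b) - (s n x - s n b)) = \<bar>(s m x - s n x) - (s m b - s n b)\<bar>"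
          by simp
        also have "\<dots> \<le> K * E.seminorm (\<lambda>x. s m x - s n x)" by (rule K[OF d])
        also have "\<dots> \<le> \<bar>K\<bar> * e'"
          using M[OF mn] E.seminorm_nonneg[OF d] by (intro mult_mono) auto
        finally show ?thesis using e' by simp
      qed
      then show "\<exists>M. \<forall>m\<ge>M. \<forall>n\<ge>M. norm ((s m x - s m b) - (s n x - s n b)) < e" by blast
    qed
    then show ?thesis by (rule Cauchy_convergent)
  qed
  define l where "l x = lim (\<lambda>n. s n x - s n b)" for x
  have l: "(\<lambda>n. s n x - s n b) \<longlonglongrightarrow> l x" for x
    using conv unfolding l_def by (simp add: convergent_LIMSEQ_iff)
  have "(\<lambda>n. edge_gradient c p (s n)) \<longlonglongrightarrow> edge_gradient c p l" for p
  proof -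
    obtain x y where p: "p = (x, y)" by (cases p)
    have "(\<lambda>n. sqrt (c x y / 2) * ((s n x - s n b) - (s n y - s n b)))
        \<longlonglongrightarrow> sqrt (c x y / 2) * (l x - l y)"
      by (intro tendsto_intros l)
    then show ?thesis by (simp add: p edge_gradient_def)
  qed
  then show ?thesis
    using gradient.Cauchy_seq_tendsto[unfolded gradient_eq, OF s, of l] by blast
qed

section \<open>Classes modulo constants\<close>

definition energy_class :: "('a \<Rightarrow> real) \<Rightarrow> ('a \<Rightarrow> real) set" where
  "energy_class u = mod_const c `` {u}"

lemma mem_energy_class:
  "v \<in> energy_class u \<longleftrightarrow> u \<in> dom_energy c \<and> v \<in> dom_energy c \<and> (\<exists>k. \<forall>x. u x - v x = k)"
  by (auto simp: energy_class_def mod_const_def)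

lemma energy_class_refl: "u \<in> dom_energy c \<Longrightarrow> u \<in> energy_class u"
  by (auto simp: mem_energy_class)

lemma energy_space_eq: "energy_space c = energy_class ` dom_energy c"
  by (auto simp: energy_space_def quotient_def energy_class_def)

lemma energy_shift: "(\<And>x. u x - u' x = k) \<Longrightarrow> energy c u v = energy c u' v"
proof -
  assume *: "\<And>x. u x - u' x = k"
  have "u x - u y = u' x - u' y" for x y using *[of x] *[of y] by simp
  then show ?thesis by (simp add: energy_def)
qed

lemma energy_inner_class:
  assumes "u \<in> dom_energy c" "v \<in> dom_energy c"
  shows "energy_inner c (energy_class u) (energy_class v) = energy c u v"
proof -
  have "energy c u' v' = energy c u v" if "u' \<in> energy_class u" "v' \<in> energy_class v" for u' v'
  proof -
    obtain k k' where "\<And>x. u x - u' x = k" "\<And>x. v x - v' x = k'"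
      using \<open>u' \<in> energy_class u\<close> \<open>v' \<in> energy_class v\<close> unfolding mem_energy_class by blast
    then show ?thesis using energy_shift[of u u' k] energy_shift[of v v' k'] E.sym by metis
  qed
  moreover have "\<exists>u' v'. energy c u v = energy c u' v' \<and> u' \<in> energy_class u \<and> v' \<in> energy_class v"
    using assms energy_class_refl by blast
  ultimately have "{energy c u' v' |u' v'. u' \<in> energy_class u \<and> v' \<in> energy_class v} = {energy c u v}"
    by (intro equalityI subsetI) (simp_all, blast)
  then show ?thesis by (simp add: energy_inner_def)
qed

lemma coset_diff_class:
  assumes "u \<in> dom_energy c" "v \<in> dom_energy c"
  shows "coset_diff (energy_class u) (energy_class v) = energy_class (\<lambda>x. u x - v x)"
proof (intro set_eqI iffI)
  fix w assume "w \<in> coset_diff (energy_class u) (energy_class v)"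
  then obtain u' v' k k' where w: "w = (\<lambda>x. u' x - v' x)" "u' \<in> dom_energy c" "v' \<in> dom_energy c"
    "\<And>x. u x - u' x = k" "\<And>x. v x - v' x = k'"
    by (auto simp: coset_diff_def mem_energy_class)
  have "u x - v x - w x = k - k'" for x using w(4)[of x] w(5)[of x] by (simp add: w(1))
  then show "w \<in> energy_class (\<lambda>x. u x - v x)"
    using w assms E.diff_mem by (auto simp: mem_energy_class)
next
  fix w assume "w \<in> energy_class (\<lambda>x. u x - v x)"
  then obtain k where w: "w \<in> dom_energy c" "\<And>x. u x - v x - w x = k"
    by (auto simp: mem_energy_class)
  have "(\<lambda>x. w x + v x) \<in> dom_energy c" using w assms by (intro E.add_mem)
  moreover have "u x - (w x + v x) = k" for x using w(2)[of x] by simp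
  ultimately have "(\<lambda>x. w x + v x) \<in> energy_class u" using assms by (auto simp: mem_energy_class)
  then show "w \<in> coset_diff (energy_class u) (energy_class v)"
    unfolding coset_diff_def using energy_class_refl[OF assms(2)]
    by (intro CollectI exI[of _ "\<lambda>x. w x + v x"] exI[of _ v]) simp
qed

text \<open>This turns uniqueness of representers up to energy zero into uniqueness of classes.\<close>
lemma energy_class_eqI:
  assumes "u \<in> dom_energy c" "v \<in> dom_energy c"
    and "energy c (\<lambda>x. u x - v x) (\<lambda>x. u x - v x) = 0"
  shows "energy_class u = energy_class v"
proof -
  have const: "u x - v x = u y - v y" for x y
    using energy_zero_imp_constant[OF E.diff_mem[OF assms(1,2)] assms(3), of x y] by simp
  define k where "k = u undefined - v undefined"
  have k: "u x = v x + k" for x using const[of x undefined] by (simp add: k_def)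
  have "(\<exists>j. \<forall>x. u x - w x = j) \<longleftrightarrow> (\<exists>j. \<forall>x. v x - w x = j)" for w
  proof
    assume "\<exists>j. \<forall>x. u x - w x = j"
    then obtain j where "\<forall>x. u x - w x = j" by blast
    then have "\<forall>x. v x - w x = j - k" using k by (simp add: algebra_simps)
    then show "\<exists>j. \<forall>x. v x - w x = j" by blast
  next
    assume "\<exists>j. \<forall>x. v x - w x = j"
    then obtain j where "\<forall>x. v x - w x = j" by blast
    then have "\<forall>x. u x - w x = j + k" using k by (simp add: algebra_simps)
    then show "\<exists>j. \<forall>x. u x - w x = j" by blast
  qed
  then show ?thesis using assms by (auto simp: mem_energy_class)
qed

text \<open>The representatives of the elements of \<open>Fin\<close>, as \<open>Fin_eq\<close> shows.\<close>
definition fin_functions :: "('a \<Rightarrow> real) set" where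
  "fin_functions = {u \<in> dom_energy c. \<exists>\<phi> :: nat \<Rightarrow> 'a \<Rightarrow> real. (\<forall>n. \<phi> n \<in> dirac_span) \<and>
     (\<lambda>n. E.seminorm (\<lambda>x. \<phi> n x - u x)) \<longlonglongrightarrow> 0}"

lemma Fin_eq: "Fin c = energy_class ` fin_functions"
proof -
  have norm_eq: "energy_norm c (coset_diff (mod_const c `` {\<phi>}) (energy_class u))
      = E.seminorm (\<lambda>x. \<phi> x - u x)" if "\<phi> \<in> dirac_span" "u \<in> dom_energy c" for \<phi> u
  proof -
    have \<phi>: "\<phi> \<in> dom_energy c" using that dirac_span_dom_energy by blast
    show ?thesis
      using coset_diff_class[OF \<phi> that(2)] energy_inner_class[OF E.diff_mem E.diff_mem] \<phi> that(2)
      by (simp add: energy_norm_def E.seminorm_def flip: energy_class_def)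
  qed
  have "energy_class u \<in> Fin c \<longleftrightarrow> u \<in> fin_functions" if u: "u \<in> dom_energy c" for u
    unfolding Fin_def fin_functions_def mem_Collect_eq
    using u by (simp add: norm_eq energy_space_eq cong: conj_cong)
  moreover have "Fin c \<subseteq> energy_class ` dom_energy c" "fin_functions \<subseteq> dom_energy c"
    by (auto simp: Fin_def energy_space_eq fin_functions_def)
  ultimately show ?thesis by blast
qed

lemma fin_functions_approx:
  "u \<in> fin_functions \<longleftrightarrow> u \<in> dom_energy c \<and>
     (\<forall>e>0. \<exists>\<phi>\<in>dirac_span. E.seminorm (\<lambda>x. \<phi> x - u x) < e)"
proof (intro iffI conjI allI impI)
  assume u: "u \<in> fin_functions"
  then show "u \<in> dom_energy c" by (simp add: fin_functions_def)
  fix e :: real assume "e > 0"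
  obtain \<phi> where \<phi>: "\<And>n. \<phi> n \<in> dirac_span" "(\<lambda>n. E.seminorm (\<lambda>x. \<phi> n x - u x)) \<longlonglongrightarrow> 0"
    using u by (auto simp: fin_functions_def)
  then have "\<forall>\<^sub>F n in sequentially. E.seminorm (\<lambda>x. \<phi> n x - u x) < e"
    using \<open>e > 0\<close> by (intro order_tendstoD(2))
  then show "\<exists>\<phi>\<in>dirac_span. E.seminorm (\<lambda>x. \<phi> x - u x) < e"
    using \<phi>(1) by (auto simp: eventually_sequentially)
next
  assume *: "u \<in> dom_energy c \<and> (\<forall>e>0. \<exists>\<phi>\<in>dirac_span. E.seminorm (\<lambda>x. \<phi> x - u x) < e)"
  then have "\<exists>\<phi>\<in>dirac_span. E.seminorm (\<lambda>x. \<phi> x - u x) < inverse (real (Suc n))" for n by simp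
  then obtain \<phi> where \<phi>: "\<And>n. \<phi> n \<in> dirac_span"
    "\<And>n. E.seminorm (\<lambda>x. \<phi> n x - u x) < inverse (real (Suc n))" by metis
  have "E.seminorm (\<lambda>x. \<phi> n x - u x) \<ge> 0" for n
    using * \<phi>(1) dirac_span_dom_energy by (intro E.seminorm_nonneg E.diff_mem) auto
  then have "(\<lambda>n. E.seminorm (\<lambda>x. \<phi> n x - u x)) \<longlonglongrightarrow> 0"
    using \<phi>(2) less_imp_le
    by (intro tendsto_sandwich[OF _ _ tendsto_const LIMSEQ_inverse_real_of_nat] always_eventually) auto
  then show "u \<in> fin_functions" using * \<phi>(1) by (auto simp: fin_functions_def)
qed

lemma fin_functions_dom: "fin_functions \<subseteq> dom_energy c"
  by (auto simp: fin_functions_def)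

lemma dirac_span_fin: "dirac_span \<subseteq> fin_functions"
proof
  fix \<phi> :: "'a \<Rightarrow> real" assume \<phi>: "\<phi> \<in> dirac_span"
  have "E.seminorm (\<lambda>x. \<phi> x - \<phi> x) = 0" by (simp add: E.seminorm_def energy_def case_prod_unfold)
  then show "\<phi> \<in> fin_functions"
    using \<phi> dirac_span_dom_energy unfolding fin_functions_approx by force
qed

sublocale F: semi_inner fin_functions "energy c"
proof (rule semi_inner_subspace[OF E.semi_inner_axioms fin_functions_dom])
  show "fin_functions \<noteq> {}" using dirac_span_fin dirac_span_ne by blast
  fix u v t assume uv: "u \<in> fin_functions" "v \<in> fin_functions"
  then obtain \<phi> \<psi> where \<phi>: "\<And>n. \<phi> n \<in> dirac_span" "(\<lambda>n. E.seminorm (\<lambda>x. \<phi> n x - u x)) \<longlonglongrightarrow> 0"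
    and \<psi>: "\<And>n. \<psi> n \<in> dirac_span" "(\<lambda>n. E.seminorm (\<lambda>x. \<psi> n x - v x)) \<longlonglongrightarrow> 0"
    unfolding fin_functions_def by blast
  let ?\<chi> = "\<lambda>n x. \<phi> n x + t * \<psi> n x"
  have dom: "u \<in> dom_energy c" "v \<in> dom_energy c" "\<And>n. \<phi> n \<in> dom_energy c" "\<And>n. \<psi> n \<in> dom_energy c"
    using uv \<phi>(1) \<psi>(1) fin_functions_dom dirac_span_dom_energy by blast+
  have "(\<lambda>n. E.seminorm (\<lambda>x. ?\<chi> n x - (u x + t * v x))) \<longlonglongrightarrow> 0"
  proof (rule tendsto_sandwich[OF _ _ tendsto_const])
    show "(\<lambda>n. E.seminorm (\<lambda>x. \<phi> n x - u x) + \<bar>t\<bar> * E.seminorm (\<lambda>x. \<psi> n x - v x)) \<longlonglongrightarrow> 0"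
      using tendsto_add[OF \<phi>(2) tendsto_mult_left[OF \<psi>(2), of "\<bar>t\<bar>"]] by simp
    show "\<forall>\<^sub>F n in sequentially. 0 \<le> E.seminorm (\<lambda>x. ?\<chi> n x - (u x + t * v x))"
      using dom by (intro always_eventually allI E.seminorm_nonneg E.diff_mem E.comb)
    have "E.seminorm (\<lambda>x. ?\<chi> n x - (u x + t * v x))
        \<le> E.seminorm (\<lambda>x. \<phi> n x - u x) + \<bar>t\<bar> * E.seminorm (\<lambda>x. \<psi> n x - v x)" for n
    proof -
      have d: "(\<lambda>x. \<phi> n x - u x) \<in> dom_energy c" "(\<lambda>x. \<psi> n x - v x) \<in> dom_energy c"
        using dom by (auto intro: E.diff_mem)
      have "(\<lambda>x. ?\<chi> n x - (u x + t * v x)) = (\<lambda>x. (\<phi> n x - u x) + t * (\<psi> n x - v x))"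
        by (simp add: algebra_simps)
      then show ?thesis
        using E.triangle[OF d(1) E.scale_mem[OF d(2), of t]] E.seminorm_scale[OF d(2), of t]
        by (simp only:)
    qed
    then show "\<forall>\<^sub>F n in sequentially. E.seminorm (\<lambda>x. ?\<chi> n x - (u x + t * v x))
        \<le> E.seminorm (\<lambda>x. \<phi> n x - u x) + \<bar>t\<bar> * E.seminorm (\<lambda>x. \<psi> n x - v x)"
      by simp
  qed
  moreover have "?\<chi> n \<in> dirac_span" for n using \<phi>(1) \<psi>(1) by (rule dirac_span_comb)
  moreover have "(\<lambda>x. u x + t * v x) \<in> dom_energy c" using dom by (intro E.comb)
  ultimately show "(\<lambda>x. u x + t * v x) \<in> fin_functions"
    unfolding fin_functions_def by (intro CollectI conjI exI[of _ ?\<chi>] allI)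
qed

lemma fin_functions_complete:
  assumes s: "F.Cauchy_seq s"
  shows "\<exists>l\<in>fin_functions. (\<lambda>n. E.seminorm (\<lambda>x. s n x - l x)) \<longlonglongrightarrow> 0"
proof -
  have mem: "s n \<in> fin_functions" for n using s by (simp add: F.Cauchy_seq_def)
  have "E.Cauchy_seq s"
    using s fin_functions_dom unfolding F.Cauchy_seq_def E.Cauchy_seq_def by blast
  then obtain l where l: "l \<in> dom_energy c" "(\<lambda>n. E.seminorm (\<lambda>x. s n x - l x)) \<longlonglongrightarrow> 0"
    using energy_complete by blast
  have "\<exists>\<phi>\<in>dirac_span. E.seminorm (\<lambda>x. \<phi> x - l x) < e" if e: "e > 0" for e
  proof -
    have "\<forall>\<^sub>F n in sequentially. E.seminorm (\<lambda>x. s n x - l x) < e / 2"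
      using l(2) e by (intro order_tendstoD(2)) auto
    then obtain n where n: "E.seminorm (\<lambda>x. s n x - l x) < e / 2"
      by (auto simp: eventually_sequentially)
    obtain \<phi> where \<phi>: "\<phi> \<in> dirac_span" "E.seminorm (\<lambda>x. \<phi> x - s n x) < e / 2"
      using mem[of n] e unfolding fin_functions_approx by (meson half_gt_zero)
    have "E.seminorm (\<lambda>x. \<phi> x - l x) < e"
      using E.triangle_diff[of \<phi> "s n" l] \<phi> n l(1) mem[of n] fin_functions_dom dirac_span_dom_energy
      by force
    then show ?thesis using \<phi>(1) by blast
  qed
  then show ?thesis using l by (auto simp: fin_functions_approx)
qed

section \<open>Dipoles, projections and wired resistance\<close>

lemma dipole_representation:
  obtains v where "v \<in> dom_energy c" "dipole c b x = energy_class v"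
    "\<And>u. u \<in> dom_energy c \<Longrightarrow> energy c v u = u x - u b"
proof -
  obtain K where K: "\<And>u. u \<in> dom_energy c \<Longrightarrow> \<bar>u x - u b\<bar> \<le> K * E.seminorm u"
    using oscillation_bound[of x b] by blast
  have "\<exists>v\<in>dom_energy c. \<forall>u\<in>dom_energy c. energy c v u = u x - u b"
    using K by (intro E.riesz_representation energy_complete) (auto simp: algebra_simps)
  then obtain v where v: "v \<in> dom_energy c" "\<And>u. u \<in> dom_energy c \<Longrightarrow> energy c v u = u x - u b"
    by blast
  have shift: "w x - w b = u x - u b" if w: "w \<in> energy_class u" for u w
  proof -
    obtain k where "\<And>x. u x - w x = k" using w unfolding mem_energy_class by blast
    from this[of x] this[of b] show ?thesis by linarith
  qed
  have "dipole c b x = energy_class v"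
    unfolding dipole_def
  proof (rule the_equality)
    show "energy_class v \<in> energy_space c \<and>
        (\<forall>U\<in>energy_space c. \<forall>u\<in>U. energy_inner c (energy_class v) U = u x - u b)"
      using v shift by (auto simp: energy_space_eq energy_inner_class)
    fix V
    assume V: "V \<in> energy_space c \<and>
        (\<forall>U\<in>energy_space c. \<forall>u\<in>U. energy_inner c V U = u x - u b)"
    then obtain v' where v': "v' \<in> dom_energy c" "V = energy_class v'"
      by (auto simp: energy_space_eq)
    have *: "energy c v' u = u x - u b" if "u \<in> dom_energy c" for u
      using V v' that energy_class_refl[OF that] energy_inner_class[OF v'(1) that]
      by (auto simp: energy_space_eq)
    have "energy c (\<lambda>x. v' x - v x) (\<lambda>x. v' x - v x) = 0"
      using v v'(1) * E.diff_mem[OF v'(1) v(1)] by (simp add: E.diff_left)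
    then show "V = energy_class v" using energy_class_eqI v' v(1) by simp
  qed
  then show ?thesis using v that by blast
qed

text \<open>On \<open>Fin\<close>, the orthogonality condition says that the projection represents the restriction of
  \<open>w \<mapsto> \<E>(v, w)\<close>, so it is again a Riesz representer.\<close>
lemma proj_Fin_representation:
  assumes v: "v \<in> dom_energy c"
  obtains f where "f \<in> fin_functions" "proj_Fin c (energy_class v) = energy_class f"
    "\<And>w. w \<in> fin_functions \<Longrightarrow> energy c f w = energy c v w"
proof -
  have "\<exists>f\<in>fin_functions. \<forall>w\<in>fin_functions. energy c f w = energy c v w"
  proof (rule F.riesz_representation[OF fin_functions_complete])
    show "energy c v (\<lambda>x. u x + t * w x) = energy c v u + t * energy c v w"
      if "u \<in> fin_functions" "w \<in> fin_functions" for u w t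
      using that v fin_functions_dom by (intro E.linear_right) auto
    show "\<bar>energy c v u\<bar> \<le> E.seminorm v * E.seminorm u" if "u \<in> fin_functions" for u
      using that v fin_functions_dom by (intro E.Cauchy_Schwarz) auto
  qed
  then obtain f where f: "f \<in> fin_functions"
    "\<And>w. w \<in> fin_functions \<Longrightarrow> energy c f w = energy c v w" by blast
  have orth: "(\<forall>W\<in>Fin c. energy_inner c (coset_diff (energy_class v) (energy_class g)) W = 0)
      \<longleftrightarrow> (\<forall>w\<in>fin_functions. energy c g w = energy c v w)" if "g \<in> fin_functions" for g
  proof -
    have g: "g \<in> dom_energy c" using that fin_functions_dom by blast
    have "energy_inner c (coset_diff (energy_class v) (energy_class g)) (energy_class w)
        = energy c v w - energy c g w" if "w \<in> fin_functions" for w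
      using that fin_functions_dom v g E.diff_mem[OF v g]
      by (simp add: coset_diff_class energy_inner_class E.diff_left subset_iff)
    then show ?thesis by (auto simp: Fin_eq)
  qed
  have "proj_Fin c (energy_class v) = energy_class f"
    unfolding proj_Fin_def
  proof (rule the_equality)
    show "energy_class f \<in> Fin c \<and>
        (\<forall>W\<in>Fin c. energy_inner c (coset_diff (energy_class v) (energy_class f)) W = 0)"
      using f orth by (auto simp: Fin_eq)
    fix G
    assume G: "G \<in> Fin c \<and> (\<forall>W\<in>Fin c. energy_inner c (coset_diff (energy_class v) G) W = 0)"
    then obtain g where g: "g \<in> fin_functions" "G = energy_class g" by (auto simp: Fin_eq)
    have *: "energy c g w = energy c v w" if "w \<in> fin_functions" for w
      using G g orth that by blast
    have "energy c (\<lambda>x. g x - f x) (\<lambda>x. g x - f x) = 0"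
      using f g(1) * F.diff_mem[OF g(1) f(1)] by (simp add: F.diff_left)
    then show "G = energy_class f"
      using energy_class_eqI[of g f] g f(1) fin_functions_dom by auto
  qed
  then show ?thesis using f that by blast
qed

text \<open>The wired resistance is the squared norm on \<open>Fin\<close> of the functional \<open>w \<mapsto> w(x) - w(y)\<close>: the
  reference vertex cancels in the difference of the two dipoles.\<close>
lemma wired_resistance_representation:
  obtains h where "h \<in> fin_functions" "wired_resistance c b x y = energy c h h"
    "\<And>w. w \<in> fin_functions \<Longrightarrow> energy c h w = w x - w y"
proof -
  obtain v where v: "v \<in> dom_energy c" "dipole c b x = energy_class v"
    "\<And>u. u \<in> dom_energy c \<Longrightarrow> energy c v u = u x - u b"
    using dipole_representation[of b x] by blast
  obtain v' where v': "v' \<in> dom_energy c" "dipole c b y = energy_class v'"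
    "\<And>u. u \<in> dom_energy c \<Longrightarrow> energy c v' u = u y - u b"
    using dipole_representation[of b y] by blast
  obtain f where f: "f \<in> fin_functions" "proj_Fin c (energy_class v) = energy_class f"
    "\<And>w. w \<in> fin_functions \<Longrightarrow> energy c f w = energy c v w"
    using proj_Fin_representation[OF v(1)] by blast
  obtain f' where f': "f' \<in> fin_functions" "proj_Fin c (energy_class v') = energy_class f'"
    "\<And>w. w \<in> fin_functions \<Longrightarrow> energy c f' w = energy c v' w"
    using proj_Fin_representation[OF v'(1)] by blast
  let ?h = "\<lambda>x. f x - f' x"
  have dom: "f \<in> dom_energy c" "f' \<in> dom_energy c" using f f' fin_functions_dom by auto
  show ?thesis
  proof (rule that[of ?h])
    show "?h \<in> fin_functions" using f f' by (intro F.diff_mem)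
    show "wired_resistance c b x y = energy c ?h ?h"
      using dom E.diff_mem[OF dom]
      by (simp add: wired_resistance_def v v' f f' coset_diff_class energy_inner_class)
    show "energy c ?h w = w x - w y" if w: "w \<in> fin_functions" for w
      using w f f' v v' fin_functions_dom by (simp add: F.diff_left subset_iff)
  qed
qed

lemma wired_resistance_nonneg: "0 \<le> wired_resistance c b x y"
proof -
  obtain h where "h \<in> fin_functions" "wired_resistance c b x y = energy c h h"
    using wired_resistance_representation[of b x y] by blast
  then show ?thesis using F.pos by simp
qed

text \<open>Write \<open>h\<close> for the representer and \<open>\<phi>\<^sub>n \<longlonglongrightarrow> h\<close> for finitely supported approximants. Then
  \<open>\<E>(\<phi>\<^sub>n, h)\<^sup>2 = (\<phi>\<^sub>n(x) - \<phi>\<^sub>n(y))\<^sup>2 \<le> 2 \<parallel>\<phi>\<^sub>n\<parallel>\<^sup>2 \<le> (2 / \<gamma>) \<E>(\<phi>\<^sub>n)\<close>, and in the limit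
  \<open>\<E>(h)\<^sup>2 \<le> (2 / \<gamma>) \<E>(h)\<close>.\<close>
theorem wired_resistance_le:
  assumes \<gamma>: "\<gamma> > 0" and spec: "spec (laplacian2 c) \<subseteq> {\<gamma>..}"
  shows "wired_resistance c b x y \<le> 2 / \<gamma>"
proof -
  obtain h where h: "h \<in> fin_functions" "wired_resistance c b x y = energy c h h"
    "\<And>w. w \<in> fin_functions \<Longrightarrow> energy c h w = w x - w y"
    using wired_resistance_representation[of b x y] by blast
  obtain \<phi> where \<phi>: "\<And>n. \<phi> n \<in> dirac_span" "(\<lambda>n. E.seminorm (\<lambda>x. \<phi> n x - h x)) \<longlonglongrightarrow> 0"
    using h(1) unfolding fin_functions_def by blast
  have dom: "h \<in> dom_energy c" "\<And>n. \<phi> n \<in> dom_energy c" "\<And>n. \<phi> n \<in> fin_functions" "\<And>n. \<phi> n \<in> l2"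
    using h(1) \<phi>(1) fin_functions_dom dirac_span_fin dirac_span_l2 by blast+
  define s where "s = sqrt (2 / \<gamma>)"
  have s: "s \<ge> 0" "s\<^sup>2 = 2 / \<gamma>" using \<gamma> by (simp_all add: s_def)
  have bound: "energy c (\<phi> n) h \<le> s * (E.seminorm h + E.seminorm (\<lambda>x. \<phi> n x - h x))" for n
  proof -
    have "(energy c (\<phi> n) h)\<^sup>2 = (\<phi> n x - \<phi> n y)\<^sup>2"
      using h(3)[OF dom(3)] E.sym by metis
    also have "\<dots> \<le> 2 / \<gamma> * (\<gamma> * l2_inner (\<phi> n) (\<phi> n))"
      using point_difference_bound[OF dom(4)] \<gamma> by simp
    also have "\<dots> \<le> 2 / \<gamma> * energy c (\<phi> n) (\<phi> n)"
      using poincare_inequality[OF spec \<phi>(1)] \<gamma> by (intro mult_left_mono) auto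
    also have "\<dots> = (s * E.seminorm (\<phi> n))\<^sup>2"
      using s E.seminorm_square[OF dom(2)] by (simp add: power_mult_distrib)
    finally have "energy c (\<phi> n) h \<le> s * E.seminorm (\<phi> n)"
      using s E.seminorm_nonneg[OF dom(2)] by (auto elim: power2_le_imp_le)
    also have "E.seminorm (\<phi> n) \<le> E.seminorm h + E.seminorm (\<lambda>x. \<phi> n x - h x)"
      using E.triangle[OF dom(1) E.diff_mem[OF dom(2) dom(1)]] by simp
    finally show ?thesis using s(1) by (simp add: mult_left_mono)
  qed
  have "energy c h h \<le> s * (E.seminorm h + 0)"
  proof (rule LIMSEQ_le)
    show "(\<lambda>n. energy c (\<phi> n) h) \<longlonglongrightarrow> energy c h h"
      by (rule E.inner_tendsto[OF dom(2,1,1) \<phi>(2)])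
    show "(\<lambda>n. s * (E.seminorm h + E.seminorm (\<lambda>x. \<phi> n x - h x))) \<longlonglongrightarrow> s * (E.seminorm h + 0)"
      by (intro tendsto_intros \<phi>(2))
  qed (use bound in blast)
  then have "E.seminorm h * E.seminorm h \<le> s * E.seminorm h"
    using E.seminorm_square[OF dom(1)] by (simp add: power2_eq_square)
  then have "E.seminorm h \<le> s"
    using s(1) E.seminorm_nonneg[OF dom(1)] by (auto simp: mult_le_cancel_right order.order_iff_strict)
  then have "(E.seminorm h)\<^sup>2 \<le> 2 / \<gamma>"
    using E.seminorm_nonneg[OF dom(1)] power_mono[of "E.seminorm h" s 2] unfolding s(2) by simp
  then show ?thesis using h(2) E.seminorm_square[OF dom(1)] by simp
qed

end

text \<open>The infimum is an extended real and may be \<open>\<infinity>\<close>, so \<open>\<gamma>\<close> is chosen strictly between 0 and it.\<close>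
lemma spectral_gap_obtains:
  assumes "spectral_gap T"
  obtains \<gamma> where "\<gamma> > 0" "spec T \<subseteq> {\<gamma>..}"
proof -
  obtain z where z: "0 < z" "z < (INF r\<in>spec T. ereal r)"
    using assms dense unfolding spectral_gap_def by blast
  then obtain \<gamma> where \<gamma>: "z = ereal \<gamma>"
    by (cases z) auto
  have "\<gamma> \<le> r" if "r \<in> spec T" for r
    using INF_lower[OF that, of ereal] z(2) \<gamma> by (metis ereal_less_eq(3) less_le_trans less_imp_le)
  then show ?thesis using that z(1) \<gamma> by auto
qed

theorem corollary6p9:
  fixes c :: "'a \<Rightarrow> 'a \<Rightarrow> real" and x\<^sub>0 :: 'a
  assumes "network c"
    and "infinite (UNIV :: 'a set)"
    and "transient c"
  shows "(spectral_gap (laplacian2 c) \<longrightarrow> bounded (range (\<lambda>(x, y). wired_resistance c x\<^sub>0 x y))) \<and>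
    (\<forall>\<gamma>>0. spec (laplacian2 c) \<subseteq> {\<gamma>..} \<longrightarrow> (\<forall>x y. wired_resistance c x\<^sub>0 x y \<le> 2 / \<gamma>))"
proof -
  interpret network c by fact
  show ?thesis
  proof (intro conjI impI allI)
    assume "spectral_gap (laplacian2 c)"
    then obtain \<gamma> where "\<gamma> > 0" "spec (laplacian2 c) \<subseteq> {\<gamma>..}" by (rule spectral_gap_obtains)
    then have "\<bar>wired_resistance c x\<^sub>0 x y\<bar> \<le> 2 / \<gamma>" for x y
      using wired_resistance_le wired_resistance_nonneg by simp
    then show "bounded (range (\<lambda>(x, y). wired_resistance c x\<^sub>0 x y))"
      by (intro boundedI[of _ "2 / \<gamma>"]) auto
  qed (rule wired_resistance_le)
qed

end
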